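(* Fix integers $m\ge d\ge1$, $\lambda=d/m$, and a monic polynomial $p$ of degree $d$ with real nonnegative roots, $\mu=\mu_{\mathbb{S}p}$. Then, as power series in $s$ at $0$, \[ \widetilde{\mathcal R}^{d,\lambda}_\mu(s)\equiv\mathcal R^{d,\lambda}_{\mathbb{S}p}(s^2)\pmod{s^{d+1}}, \] i.e. the coefficients of $s^0,\dots,s^d$ of the two sides agree.
   Context: Let $R$ be the largest root of $p$, $\mathbb{S}p(x)=p(x^2)$. $\mathcal G(x)=\frac1d\frac{xp'(x^2)}{p(x^2)}$, $\mathcal H(x)=\mathcal G(x)(\lambda\mathcal G(x)+(1-\lambda)/x)$, a decreasing bijection $(\sqrt R,\infty)\to(0,\infty)$ with inverse $\mathcal J$. For $s>0$: $z=\mathcal J(s^2)$, $r(s)=\frac1{\sqrt{md}}\frac{zp'(z^2)}{p(z^2)}$, $t(s)=r(s)+\frac{m-d}{\sqrt{md}z}$; $r,t$ extend analytically to a neighborhood of $0$ with $r(s)=s+O(s^2)$, $t(s)=s+O(s^2)$. $X=[\sqrt R,\infty)^2$, $\Delta(x,y)=y^{(m-d)/\sqrt{md}}p(xy)^{1/\sqrt{md}}$, $\|f\|_q=(\iint_Xf^q\,dx\,dy)^{1/q}$, $\mathcal Q^{d,\lambda}_\mu(s)=\big[\partial_r\log\|e^{-xr-yt}\Delta\|_{\sqrt{md}}\cdot\partial_t\log\|e^{-xr-yt}\Delta\|_{\sqrt{md}}\big]_{r=r(s),t=t(s)}$, and $\widetilde{\mathcal R}^{d,\lambda}_\mu(s)=\sqrt{\frac1\lambda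 s^2\mathcal Q^{d,\lambda}_\mu(s)+\frac{(1-\lambda)^2}{4\lambda^2}}-\big(\frac{\lambda+1}{2\lambda}+\frac1d\big)$, which extends analytically to a neighborhood of $s=0$ (so it has a power series expansion there). Finite $R$-transform: writing $p=\sum_{i=0}^d(-1)^ip_ix^{d-i}$ and $E_p(s)=\sum_{i=0}^d(-1)^i(md)^i\frac{(m-i)!(d-i)!}{m!d!}p_is^i$, $\mathcal R^{d,\lambda}_{\mathbb{S}p}(s)$ is the polynomial of degree $\le d$ agreeing with $-\frac sd\frac d{ds}\log E_p(s)$ mod $s^{d+1}$. *)

theory Defs
  imports "HOL-Analysis.Analysis" "HOL-Computational_Algebra.Polynomial"
    "HOL-Computational_Algebra.Formal_Power_Series"
begin

definition lam :: "nat \<Rightarrow> nat \<Rightarrow> real" where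
  "lam m d = real d / real m"

definition Rroot :: "real poly \<Rightarrow> real" where
  "Rroot p = Max {x. poly p x = 0}"

definition Gfun :: "nat \<Rightarrow> real poly \<Rightarrow> real \<Rightarrow> real" where
  "Gfun d p x = (1 / real d) * (x * poly (pderiv p) (x^2) / poly p (x^2))"

definition Hfun :: "nat \<Rightarrow> nat \<Rightarrow> real poly \<Rightarrow> real \<Rightarrow> real" where
  "Hfun m d p x = Gfun d p x * (lam m d * Gfun d p x + (1 - lam m d) / x)"

text \<open>Inverse J of the bijection H : (sqrt R, infinity) -> (0, infinity).\<close>
definition Jfun :: "nat \<Rightarrow> nat \<Rightarrow> real poly \<Rightarrow> real \<Rightarrow> real" where
  "Jfun m d p u = (THE z. z > sqrt (Rroot p) \<and> Hfun m d p z = u)"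

definition zfun :: "nat \<Rightarrow> nat \<Rightarrow> real poly \<Rightarrow> real \<Rightarrow> real" where
  "zfun m d p s = Jfun m d p (s^2)"

definition rfun :: "nat \<Rightarrow> nat \<Rightarrow> real poly \<Rightarrow> real \<Rightarrow> real" where
  "rfun m d p s = (let z = zfun m d p s in
     1 / sqrt (real m * real d) * (z * poly (pderiv p) (z^2) / poly p (z^2)))"

definition tfun :: "nat \<Rightarrow> nat \<Rightarrow> real poly \<Rightarrow> real \<Rightarrow> real" where
  "tfun m d p s = rfun m d p s
     + (real m - real d) / (sqrt (real m * real d) * zfun m d p s)"

definition Xset :: "real poly \<Rightarrow> (real \<times> real) set" where
  "Xset p = {sqrt (Rroot p)..} \<times> {sqrt (Rroot p)..}"

definition Delta :: "nat \<Rightarrow> nat \<Rightarrow> real poly \<Rightarrow> real \<Rightarrow> real \<Rightarrow> real" where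
  "Delta m d p x y = y powr ((real m - real d) / sqrt (real m * real d))
      * poly p (x * y) powr (1 / sqrt (real m * real d))"

definition qnorm :: "real poly \<Rightarrow> real \<Rightarrow> (real \<Rightarrow> real \<Rightarrow> real) \<Rightarrow> real" where
  "qnorm p q f = (integral (Xset p) (\<lambda>(x, y). f x y powr q)) powr (1 / q)"

definition Nfun :: "nat \<Rightarrow> nat \<Rightarrow> real poly \<Rightarrow> real \<Rightarrow> real \<Rightarrow> real" where
  "Nfun m d p r t = qnorm p (sqrt (real m * real d))
      (\<lambda>x y. exp (- x * r - y * t) * Delta m d p x y)"

definition Qfun :: "nat \<Rightarrow> nat \<Rightarrow> real poly \<Rightarrow> real \<Rightarrow> real" where
  "Qfun m d p s =
     deriv (\<lambda>r. ln (Nfun m d p r (tfun m d p s))) (rfun m d p s)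
   * deriv (\<lambda>t. ln (Nfun m d p (rfun m d p s) t)) (tfun m d p s)"

definition Rtilde :: "nat \<Rightarrow> nat \<Rightarrow> real poly \<Rightarrow> real \<Rightarrow> real" where
  "Rtilde m d p s =
     sqrt (1 / lam m d * s^2 * Qfun m d p s + (1 - lam m d)^2 / (4 * (lam m d)^2))
     - ((lam m d + 1) / (2 * lam m d) + 1 / real d)"

text \<open>p = sum_i (-1)^i p_i x^(d-i).\<close>
definition pcoef :: "nat \<Rightarrow> real poly \<Rightarrow> nat \<Rightarrow> real" where
  "pcoef d p i = (-1)^i * coeff p (d - i)"

definition Efps :: "nat \<Rightarrow> nat \<Rightarrow> real poly \<Rightarrow> real fps" where
  "Efps m d p = Abs_fps (\<lambda>i. if i \<le> d then
      (-1)^i * (real m * real d)^i * (fact (m - i) * fact (d - i) / (fact m * fact d))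
        * pcoef d p i
      else 0)"

definition Rfps :: "nat \<Rightarrow> nat \<Rightarrow> real poly \<Rightarrow> real fps" where
  "Rfps m d p = - fps_const (1 / real d) * fps_X * fps_deriv (Efps m d p) / Efps m d p"

definition Rtransform :: "nat \<Rightarrow> nat \<Rightarrow> real poly \<Rightarrow> real poly" where
  "Rtransform m d p = (\<Sum>k\<le>d. monom (fps_nth (Rfps m d p) k) k)"

end

theory Submission
  imports Defs "HOL-Complex_Analysis.Complex_Analysis" "HOL-Library.Landau_Symbols"
    "HOL-Computational_Algebra.Fundamental_Theorem_Algebra"
begin

text \<open>
  Put \<open>q = sqrt (m d)\<close>, \<open>\<rho> = sqrt R\<close> and \<open>c j = coeff p j\<close>. The \<open>q\<close>-th power of the norm is the
  Laplace integral \<open>I(r, t) = (\<Sum>j\<le>d. c j * A j (q r) * A (j + m - d) (q t))\<close>, where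
  \<open>A k u\<close>, the integral of \<open>x ^ k * exp (- u x)\<close> over \<open>x \<ge> \<rho>\<close>, equals \<open>k! / u ^ (k + 1)\<close> up to an entire
  function and satisfies \<open>A k' = - A (k + 1)\<close>. Since \<open>r t = s\<^sup>2\<close> with \<open>r\<close>, \<open>t\<close> of order \<open>s\<close>, clearing the
  poles turns \<open>I\<close> into \<open>d! m! E(s\<^sup>2) + O(s ^ (d + 1))\<close>, and the logarithmic derivatives along
  \<open>r \<partial>\<^sub>r\<close> and \<open>t \<partial>\<^sub>t\<close> into
  \<open>- (d + 1 + d R(s\<^sup>2))\<close> and \<open>- (m + 1 + d R(s\<^sup>2))\<close> modulo \<open>s ^ (d + 1)\<close>, \<open>R\<close> being here the finite
  \<open>R\<close>-transform. Completing the square then gives the congruence. Analyticity in \<open>s\<close> comes from the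
  holomorphic inverse function theorem, applied to \<open>w = 1 / z \<mapsto> sqrt (H(1 / w))\<close>.
\<close>

section \<open>Incomplete gamma functions and Laplace integrals\<close>

text \<open>\<open>gamQ k y\<close> is the regularised upper incomplete gamma function \<open>\<Gamma>(k + 1, y) / k!\<close>.\<close>
definition gamQ :: "nat \<Rightarrow> 'a \<Rightarrow> 'a::{real_normed_field,banach}" where
  "gamQ k y = exp (- y) * (\<Sum>i\<le>k. y ^ i / fact i)"

lemma gamQ_0 [simp]: "gamQ k 0 = 1"
  by (simp add: gamQ_def power_0_left if_distrib [of "\<lambda>x. x / _"] cong: if_cong)

lemma gamQ_Suc: "gamQ (Suc k) y = gamQ k y + exp (- y) * y ^ Suc k / fact (Suc k)"
  by (simp add: gamQ_def algebra_simps)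

text \<open>The derivatives of consecutive summands telescope, so only the top one survives.\<close>

lemma has_field_derivative_gamQ:
  "(gamQ k has_field_derivative - (exp (- y) * y ^ k / fact k)) (at y)"
proof (induction k)
  case 0
  show ?case by (auto simp: gamQ_def [abs_def] intro!: derivative_eq_intros)
next
  case (Suc k)
  have "((\<lambda>y. exp (- y) * y ^ Suc k / fact (Suc k)) has_field_derivative
      - (exp (- y) * y ^ Suc k / fact (Suc k)) + exp (- y) * (of_nat (Suc k) * y ^ k) / fact (Suc k)) (at y)"
    by (auto intro!: derivative_eq_intros simp: field_simps simp del: fact_Suc power_Suc)
  also have "exp (- y) * (of_nat (Suc k) * y ^ k) / fact (Suc k) = exp (- y) * y ^ k / fact k"
    by (simp add: field_simps del: of_nat_Suc)
  finally have "((\<lambda>y. exp (- y) * y ^ Suc k / fact (Suc k)) has_field_derivative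
      - (exp (- y) * y ^ Suc k / fact (Suc k)) + exp (- y) * y ^ k / fact k) (at y)" .
  from DERIV_add [OF Suc.IH this] show ?case
    by (simp add: gamQ_Suc [abs_def] del: fact_Suc power_Suc)
qed

lemmas DERIV_gamQ = DERIV_chain2 [OF has_field_derivative_gamQ]

lemma gamQ_of_real: "gamQ k (of_real y) = of_real (gamQ k y)"
  by (simp add: gamQ_def flip: exp_of_real of_real_minus)

lemma analytic_on_gamQ:
  assumes "f analytic_on A" shows "(\<lambda>z. gamQ k (f z)) analytic_on A"
  unfolding gamQ_def using assms by (intro analytic_intros) auto

lemma gamQ_at_top: "(gamQ k \<longlongrightarrow> 0) (at_top :: real filter)"
proof -
  have "((\<lambda>y::real. y ^ i / exp y / fact i) \<longlongrightarrow> 0) at_top" for i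
    using tendsto_divide [OF tendsto_power_div_exp_0 tendsto_const] by fastforce
  then have "((\<lambda>y::real. \<Sum>i\<le>k. y ^ i / exp y / fact i) \<longlongrightarrow> (\<Sum>i\<le>k. 0)) at_top"
    by (intro tendsto_sum)
  then show ?thesis
    by (simp add: gamQ_def [abs_def] sum_distrib_left exp_minus field_simps)
qed

lemma gamQ_nonneg: "0 \<le> gamQ k y" if "0 \<le> y" for y :: real
  using that by (simp add: gamQ_def sum_nonneg)

text \<open>By the mean value theorem the defect is \<open>y\<close> times a value of
  \<open>exp (- x) * x ^ k / fact k\<close> with \<open>0 < x < y\<close>, hence at most
  \<open>y * y ^ k\<close>. The power \<open>k + 1\<close> gained here is what makes the truncation
  of the domain at \<open>\<rho>\<close> negligible.\<close>

lemma gamQ_sub_one_bound: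
  fixes y :: real
  assumes "0 \<le> y"
  shows "\<bar>gamQ k y - 1\<bar> \<le> y ^ Suc k"
proof (cases "y = 0")
  case False
  with assms have "0 < y" by simp
  then obtain x where x: "0 < x" "x < y"
      "gamQ k y - gamQ k 0 = (y - 0) * - (exp (- x) * x ^ k / fact k)"
    using MVT2 [of 0 y "gamQ k" "\<lambda>x. - (exp (- x) * x ^ k / fact k)"] has_field_derivative_gamQ
    by blast
  have "exp (- x) * x ^ k / fact k \<le> 1 * x ^ k / 1"
    using x(1) fact_ge_1 [of k, where 'a = real] by (intro frac_le mult_right_mono) auto
  also have "\<dots> \<le> y ^ k"
    using x by (simp add: power_mono)
  finally have "y * (exp (- x) * x ^ k / fact k) \<le> y * y ^ k"
    using \<open>0 < y\<close> by (intro mult_left_mono) auto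
  then show ?thesis
    using x assms by (simp add: abs_mult)
qed auto

text \<open>The integral \<open>A k u\<close> in closed form: the entire factor \<open>gamQ\<close>
  is split from the pole at \<open>u = 0\<close>.\<close>

definition tail_moment :: "real \<Rightarrow> nat \<Rightarrow> real \<Rightarrow> real" where
  "tail_moment \<rho> k u = fact k * gamQ k (\<rho> * u) / u ^ Suc k"

text \<open>Moving the lower endpoint gives an antiderivative: minus the tail moment from
  \<open>x\<close> has the integrand as derivative and tends to 0 at infinity because
  \<open>gamQ\<close> does.\<close>

lemma has_bochner_integral_tail_moment:
  assumes "0 \<le> \<rho>" "0 < u"
  shows "has_bochner_integral lborel (\<lambda>x. indicator {\<rho>..} x * (x ^ k * exp (- (u * x)))) (tail_moment \<rho> k u)"
proof (rule has_bochner_integral_nn_integral)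
  let ?F = "\<lambda>x. - (fact k * gamQ k (x * u) / u ^ Suc k)"
  have "(\<integral>\<^sup>+x. ennreal (x ^ k * exp (- (u * x))) * indicator {\<rho>..} x \<partial>lborel) = ennreal (0 - ?F \<rho>)"
  proof (rule nn_integral_FTC_atLeast)
    show "DERIV ?F x :> x ^ k * exp (- (u * x))" if "\<rho> \<le> x" for x
      using assms
      by (auto intro!: derivative_eq_intros DERIV_gamQ simp: field_simps power_mult_distrib)
    have "LIM x at_top. x * u :> at_top"
      using filterlim_tendsto_pos_mult_at_top [OF tendsto_const assms(2) filterlim_ident]
      by (simp add: mult.commute)
    from filterlim_compose [OF gamQ_at_top this]
    have "(?F \<longlongrightarrow> - (fact k * 0 / u ^ Suc k)) at_top"
      using assms by (intro tendsto_intros) auto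
    then show "(?F \<longlongrightarrow> 0) at_top" by simp
  qed (use assms in auto)
  then show "(\<integral>\<^sup>+x. ennreal (indicator {\<rho>..} x * (x ^ k * exp (- (u * x)))) \<partial>lborel)
      = ennreal (tail_moment \<rho> k u)"
    unfolding tail_moment_def
    by (subst (asm) nn_integral_cong [where v = "\<lambda>x. ennreal (indicator {\<rho>..} x * (x ^ k * exp (- (u * x))))"])
      (auto simp: indicator_def)
  show "0 \<le> tail_moment \<rho> k u"
    using assms by (simp add: tail_moment_def gamQ_nonneg)
qed (use assms in \<open>auto simp: indicator_def\<close>)

text \<open>Differentiation under the integral sign, checked on the closed form: the factor
  \<open>- x\<close> raises the moment index, and \<open>gamQ_Suc\<close> supplies the extra
  summand.\<close>

lemma has_field_derivative_tail_moment:
  assumes "0 < u"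
  shows "(tail_moment \<rho> k has_field_derivative - tail_moment \<rho> (Suc k) u) (at u)"
proof -
  let ?D = "((fact k * (- (exp (- (\<rho> * u)) * (\<rho> * u) ^ k / fact k) * \<rho>)) * u ^ Suc k
        - fact k * gamQ k (\<rho> * u) * (of_nat (Suc k) * u ^ k)) / (u ^ Suc k * u ^ Suc k)"
  have "(tail_moment \<rho> k has_field_derivative ?D) (at u)"
    unfolding tail_moment_def [abs_def] using assms
    by (auto intro!: derivative_eq_intros DERIV_gamQ simp: mult_ac simp del: power_Suc)
  also have "?D = - tail_moment \<rho> (Suc k) u"
    using assms
    by (simp add: tail_moment_def gamQ_Suc field_simps power_mult_distrib del: of_nat_Suc)
  finally show ?thesis .
qed

text \<open>Tonelli for nonnegative factors gives integrability of the product together with its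
  value.\<close>

lemma has_bochner_integral_lborel_product:
  fixes f g :: "real \<Rightarrow> real"
  assumes "has_bochner_integral lborel f a" "has_bochner_integral lborel g b"
    and "\<And>x. 0 \<le> f x" "\<And>x. 0 \<le> g x"
  shows "has_bochner_integral lborel (\<lambda>(x, y). f x * g y) (a * b)"
proof -
  have [measurable]: "f \<in> borel_measurable borel" "g \<in> borel_measurable borel"
    using assms(1,2) by (auto simp: has_bochner_integral_iff)
  have a: "(\<integral>\<^sup>+x. f x \<partial>lborel) = ennreal a" and b: "(\<integral>\<^sup>+x. g x \<partial>lborel) = ennreal b"
    using assms by (auto simp: has_bochner_integral_iff nn_integral_eq_integral)
  have a0: "0 \<le> a" "0 \<le> b"
    using assms by (auto simp: has_bochner_integral_iff intro: integral_nonneg)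
  have "(\<integral>\<^sup>+z. ennreal (case z of (x, y) \<Rightarrow> f x * g y) \<partial>(lborel \<Otimes>\<^sub>M lborel))
      = (\<integral>\<^sup>+x. \<integral>\<^sup>+y. ennreal (f x * g y) \<partial>lborel \<partial>lborel)"
    by (subst lborel.nn_integral_fst [symmetric]) auto
  also have "\<dots> = (\<integral>\<^sup>+x. ennreal (f x) * ennreal b \<partial>lborel)"
    using assms by (simp add: ennreal_mult nn_integral_cmult b)
  also have "\<dots> = ennreal (a * b)"
    using a0 by (simp add: nn_integral_multc a ennreal_mult)
  finally show ?thesis
    using assms a0 unfolding lborel_prod
    by (intro has_bochner_integral_nn_integral) (auto simp: borel_prod [symmetric])
qed

text \<open>Expanding \<open>poly p (x * y)\<close> into monomials separates the variables. The
  value is computed for the Lebesgue integral and carried over to the gauge integral on which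
  \<open>qnorm\<close> is built.\<close>

lemma integral_poly_tail_moment:
  assumes "0 \<le> \<rho>" "0 < u" "0 < v"
  shows "integral ({\<rho>..} \<times> {\<rho>..})
           (\<lambda>(x, y). exp (- (u * x)) * exp (- (v * y)) * y ^ e * poly p (x * y))
         = (\<Sum>j\<le>degree p. coeff p j * (tail_moment \<rho> j u * tail_moment \<rho> (j + e) v))"
proof -
  let ?f = "\<lambda>u k x. indicator {\<rho>..} x * (x ^ k * exp (- (u * x))) :: real"
  have int: "has_bochner_integral lborel (\<lambda>z. \<Sum>j\<le>degree p. coeff p j * (case z of (x, y) \<Rightarrow> ?f u j x * ?f v (j + e) y))
      (\<Sum>j\<le>degree p. coeff p j * (tail_moment \<rho> j u * tail_moment \<rho> (j + e) v))"
    using assms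
    by (intro has_bochner_integral_sum has_bochner_integral_mult_right has_bochner_integral_lborel_product
        has_bochner_integral_tail_moment) (auto simp: indicator_def)
  have eq: "(\<lambda>z. \<Sum>j\<le>degree p. coeff p j * (case z of (x, y) \<Rightarrow> ?f u j x * ?f v (j + e) y)) =
     (\<lambda>z. if z \<in> {\<rho>..} \<times> {\<rho>..} then
       (\<lambda>(x, y). exp (- (u * x)) * exp (- (v * y)) * y ^ e * poly p (x * y)) z else 0)"
    by (auto simp: fun_eq_iff indicator_def poly_altdef sum_distrib_left power_add power_mult_distrib mult_ac)
  have "((\<lambda>z. if z \<in> {\<rho>..} \<times> {\<rho>..} then
       (\<lambda>(x, y). exp (- (u * x)) * exp (- (v * y)) * y ^ e * poly p (x * y)) z else 0) has_integral
      (\<Sum>j\<le>degree p. coeff p j * (tail_moment \<rho> j u * tail_moment \<rho> (j + e) v))) UNIV"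
    using has_integral_integral_lborel [OF integrable.intros [OF int [unfolded eq]]]
    unfolding has_bochner_integral_integral_eq [OF int [unfolded eq]] .
  then show ?thesis
    unfolding has_integral_restrict_UNIV by (rule integral_unique)
qed

lemmas DERIV_tail_moment = DERIV_chain2 [OF has_field_derivative_tail_moment]

section \<open>Real-rooted polynomials\<close>

lemma of_real_poly: "poly (map_poly of_real p) (of_real x :: complex) = of_real (poly p x)"
  by (induction p) (auto simp: map_poly_pCons)

text \<open>Induction on the degree: the fundamental theorem of algebra gives a complex root, which
  is real and nonnegative by hypothesis, and its linear factor is divided out. A list records
  multiplicities.\<close>

lemma real_nonneg_rooted_factorization:
  fixes p :: "real poly"
  assumes "lead_coeff p = 1"
    and "\<forall>z::complex. poly (map_poly complex_of_real p) z = 0 \<longrightarrow> Im z = 0 \<and> 0 \<le> Re z"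
  shows "\<exists>as. p = (\<Prod>a\<leftarrow>as. [:- a, 1:]) \<and> (\<forall>a\<in>set as. 0 \<le> a)"
  using assms
proof (induction "degree p" arbitrary: p)
  case 0
  then have "p = 1" by (metis degree_eq_zeroE lead_coeff_pCons(2) one_pCons)
  then show ?case by (intro exI [of _ "[]"]) auto
next
  case (Suc n)
  have "degree (map_poly complex_of_real p) = Suc n"
    using Suc.hyps(2) by (simp add: degree_map_poly)
  then have "\<not> constant (poly (map_poly complex_of_real p))"
    by (simp add: constant_degree)
  then obtain z where z: "poly (map_poly complex_of_real p) z = 0"
    using fundamental_theorem_of_algebra by blast
  define a where "a = Re z"
  have "0 \<le> a" "z = of_real a"
    using Suc.prems(2) z by (auto simp: a_def complex_eq_iff)
  with z have "poly p a = 0"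
    by (simp add: of_real_poly)
  then obtain q where q: "p = [:- a, 1:] * q"
    by (metis dvdE poly_eq_0_iff_dvd)
  have "q \<noteq> 0" using q Suc.hyps(2) by auto
  then have "degree p = degree [:- a, 1:] + degree q"
    unfolding q by (intro degree_mult_eq) auto
  then have "n = degree q" using Suc.hyps(2) by simp
  moreover have "lead_coeff q = 1"
    using Suc.prems(1) unfolding q lead_coeff_mult by simp
  moreover have "map_poly complex_of_real p = [:- of_real a, 1:] * map_poly complex_of_real q"
    by (rule poly_eqI) (simp add: q coeff_map_poly coeff_pCons split: nat.splits)
  then have "\<forall>z::complex. poly (map_poly complex_of_real q) z = 0 \<longrightarrow> Im z = 0 \<and> 0 \<le> Re z"
    using Suc.prems(2) by simp
  ultimately obtain as where "q = (\<Prod>a\<leftarrow>as. [:- a, 1:])" "\<forall>a\<in>set as. 0 \<le> a"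
    using Suc.hyps(1) by blast
  then show ?case
    using q \<open>0 \<le> a\<close> by (intro exI [of _ "a # as"]) auto
qed

lemma poly_prod_list_linear: "poly (\<Prod>a\<leftarrow>as. [:- a, 1:]) x = (\<Prod>a\<leftarrow>as. x - a)"
  for x :: real
  by (induction as) (auto simp: algebra_simps)

text \<open>The logarithmic derivative is additive over the factors.\<close>

lemma pderiv_over_poly_prod_list_linear:
  fixes x :: real
  assumes "x \<notin> set as"
  shows "poly (pderiv (\<Prod>a\<leftarrow>as. [:- a, 1:])) x / poly (\<Prod>a\<leftarrow>as. [:- a, 1:]) x = (\<Sum>a\<leftarrow>as. 1 / (x - a))"
  using assms
proof (induction as)
  case (Cons a as)
  let ?q = "\<Prod>a\<leftarrow>as. [:- a, 1:]"
  have "poly ?q x \<noteq> 0"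
    using Cons.prems by (auto simp: poly_prod_list_linear prod_list_zero_iff)
  moreover have "pderiv [:- a, 1:] = 1"
    by (simp add: pderiv_pCons)
  moreover have "poly (pderiv ([:- a, 1:] * ?q)) x / poly ([:- a, 1:] * ?q) x
      = 1 / (x - a) + poly (pderiv ?q) x / poly ?q x" if "poly ?q x \<noteq> 0" "pderiv [:- a, 1:] = 1"
    using that Cons.prems by (simp only: pderiv_mult) (simp add: field_simps)
  ultimately show ?case
    using Cons by simp
qed auto

lemma sum_list_strict_mono_real:
  fixes f g :: "'b \<Rightarrow> real"
  assumes "xs \<noteq> []" "\<And>x. x \<in> set xs \<Longrightarrow> f x < g x"
  shows "(\<Sum>x\<leftarrow>xs. f x) < (\<Sum>x\<leftarrow>xs. g x)"
  using assms by (induction xs rule: list_nonempty_induct) (auto intro: add_strict_mono)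

section \<open>Power series and germs of analytic functions\<close>

text \<open>Taylor expansion at 0. Since both \<open>s\<close> and the values on the positive axis
  are real, the coefficients may be replaced by their real parts.\<close>

lemma analytic_real_power_series:
  assumes "f analytic_on {0}" "eventually (\<lambda>s. f (of_real s) = of_real (\<phi> s)) (at_right 0)"
  shows "\<exists>(a :: nat \<Rightarrow> real) \<epsilon>. 0 < \<epsilon> \<and> (\<forall>s. 0 < s \<and> s < \<epsilon> \<longrightarrow> (\<lambda>k. a k * s ^ k) sums \<phi> s)"
proof -
  obtain r where r: "0 < r" "f holomorphic_on ball 0 r"
    using assms(1) by (auto simp: analytic_on_def)
  obtain \<delta> where \<delta>: "0 < \<delta>" "\<And>s. 0 < s \<Longrightarrow> s < \<delta> \<Longrightarrow> f (of_real s) = of_real (\<phi> s)"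
    using assms(2) by (auto simp: eventually_at_right_field)
  have "(\<lambda>k. Re ((deriv ^^ k) f 0 / fact k) * s ^ k) sums \<phi> s" if "0 < s" "s < min r \<delta>" for s
  proof -
    have "(\<lambda>k. (deriv ^^ k) f 0 / fact k * (of_real s - 0) ^ k) sums f (of_real s)"
      using that r by (intro holomorphic_power_series) auto
    then have "(\<lambda>k. Re ((deriv ^^ k) f 0 / fact k * of_real (s ^ k))) sums Re (f (of_real s))"
      by (intro sums_Re) simp
    moreover have "Re (z * of_real x) = Re z * x" for z x
      by simp
    ultimately show ?thesis
      using \<delta>(2) [of s] that by (simp only: min_less_iff_conj Re_complex_of_real)
  qed
  then show ?thesis
    using r(1) \<delta>(1) by (intro exI [of _ "\<lambda>k. Re ((deriv ^^ k) f 0 / fact k)"] exI [of _ "min r \<delta>"]) auto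
qed

text \<open>Once the coefficients below \<open>k\<close> vanish, \<open>\<phi> s / s ^ k\<close>
  tends to \<open>b k\<close>; being of order \<open>s ^ (n - k)\<close> with \<open>k < n\<close>,
  it also tends to 0.\<close>

lemma power_series_bigo_imp_coeff_0:
  fixes b :: "nat \<Rightarrow> real"
  assumes "0 < \<epsilon>" and sums: "\<And>s. 0 < s \<Longrightarrow> s < \<epsilon> \<Longrightarrow> (\<lambda>k. b k * s ^ k) sums \<phi> s"
    and "\<phi> \<in> O[at_right 0](\<lambda>s. s ^ n)" "k < n"
  shows "b k = 0"
  using \<open>k < n\<close>
proof (induction k rule: less_induct)
  case (less k)
  define F where "F x = (\<Sum>i. b (i + k) * x ^ i)" for x
  have shift: "(\<lambda>i. b (i + k) * s ^ i) sums (\<phi> s / s ^ k)" if "0 < s" "s < \<epsilon>" for s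
  proof -
    have "(\<lambda>i. b (i + k) * s ^ (i + k)) sums (\<phi> s - (\<Sum>i<k. b i * s ^ i))"
      by (rule sums_split_initial_segment) (use sums that in auto)
    moreover have "(\<Sum>i<k. b i * s ^ i) = 0"
      using less by (intro sum.neutral) auto
    ultimately have "(\<lambda>i. b (i + k) * s ^ (i + k) / s ^ k) sums (\<phi> s / s ^ k)"
      using sums_divide by fastforce
    then show ?thesis
      using that by (simp add: power_add)
  qed
  have "(F \<longlongrightarrow> b (0 + k)) (at 0)"
  \<comment> \<open>Convergence is given only for positive \<open>s\<close>; the single point
    \<open>\<epsilon> / 2\<close> yields it on the whole interval of that radius around 0, negative
    \<open>x\<close> included.\<close>
  proof (rule powser_limit_0 [of "\<epsilon> / 2"])
    show "(\<lambda>i. b (i + k) * x ^ i) sums F x" if "norm x < \<epsilon> / 2" for x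
    proof -
      have "summable (\<lambda>i. b (i + k) * (\<epsilon> / 2) ^ i)"
        using shift [of "\<epsilon> / 2"] \<open>0 < \<epsilon>\<close> by (auto simp: sums_iff)
      then have "summable (\<lambda>i. b (i + k) * x ^ i)"
        by (rule powser_inside) (use that in auto)
      then show ?thesis unfolding F_def by (rule summable_sums)
    qed
  qed (use \<open>0 < \<epsilon>\<close> in auto)
  then have "(F \<longlongrightarrow> b k) (at_right 0)"
    by (simp add: filterlim_at_split)
  moreover have ev: "eventually (\<lambda>s. 0 < s \<and> s < \<epsilon>) (at_right 0)"
    using \<open>0 < \<epsilon>\<close> eventually_at_right_field by blast
  have "eventually (\<lambda>s. F s = \<phi> s / s ^ k) (at_right 0)"
    using ev by eventually_elim (use shift in \<open>auto simp: F_def sums_iff\<close>)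
  ultimately have "((\<lambda>s. \<phi> s / s ^ k) \<longlongrightarrow> b k) (at_right 0)"
    by (rule Lim_transform_eventually)
  moreover have "((\<lambda>s. \<phi> s / s ^ k) \<longlongrightarrow> 0) (at_right 0)"
  proof -
    have "(\<lambda>s. \<phi> s / s ^ k) \<in> O[at_right 0](\<lambda>s. s ^ n / s ^ k)"
    proof (rule landau_o.big.divide_right [OF _ assms(3)])
      show "eventually (\<lambda>s::real. s ^ k \<noteq> 0) (at_right 0)"
        using ev by eventually_elim auto
    qed
    also have "(\<lambda>s::real. s ^ n / s ^ k) \<in> \<Theta>[at_right 0](\<lambda>s. s ^ (n - k))"
      using ev less.prems by (intro bigthetaI_cong) (auto elim!: eventually_mono simp: power_diff)
    also have "(\<lambda>s::real. s ^ (n - k)) \<in> o[at_right 0](\<lambda>_. 1)"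
    proof (rule smalloI_tendsto)
      have "((\<lambda>s::real. s ^ (n - k)) \<longlongrightarrow> 0 ^ (n - k)) (at_right 0)"
        by (intro tendsto_intros)
      then show "((\<lambda>s::real. s ^ (n - k) / 1) \<longlongrightarrow> 0) (at_right 0)"
        using less.prems by (simp add: power_0_left)
    qed auto
    finally show ?thesis
      using smalloD_tendsto by fastforce
  qed
  ultimately show ?case
    by (rule tendsto_unique [OF trivial_limit_at_right_real])
qed

text \<open>A nonzero derivative makes \<open>f\<close> injective near 0, and an injective
  holomorphic function has a holomorphic inverse on its open image.\<close>

lemma analytic_local_inverse:
  assumes "f analytic_on {0}" "f 0 = 0" "deriv f 0 \<noteq> 0"
  shows "\<exists>g. g analytic_on {0} \<and> g 0 = 0 \<and> eventually (\<lambda>z. g (f z) = z) (nhds (0::complex))"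
proof -
  obtain S where S: "open S" "0 \<in> S" "f holomorphic_on S"
    using assms(1) analytic_at by blast
  then obtain r where r: "0 < r" "ball 0 r \<subseteq> S" "inj_on f (ball 0 r)"
    using has_complex_derivative_locally_injective assms(3) by blast
  have hol: "f holomorphic_on ball 0 r"
    using S r holomorphic_on_subset by blast
  obtain g where g: "g holomorphic_on (f ` ball 0 r)" "\<And>z. z \<in> ball 0 r \<Longrightarrow> g (f z) = z"
    using holomorphic_has_inverse [OF hol open_ball r(3)] by metis
  have "open (f ` ball 0 r)"
    using open_mapping_thm3 [OF hol _ r(3)] by simp
  moreover have "0 \<in> f ` ball 0 r"
    using assms(2) r(1) by force
  ultimately have "g analytic_on {0}"
    using g(1) analytic_at by blast
  moreover have "g 0 = 0"
    using g(2) [of 0] assms(2) r(1) by simp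
  moreover have "eventually (\<lambda>z. z \<in> ball 0 r) (nhds (0::complex))"
    using r(1) by (intro eventually_nhds_in_open) auto
  then have "eventually (\<lambda>z. g (f z) = z) (nhds 0)"
    by (rule eventually_mono) (rule g(2))
  ultimately show ?thesis by blast
qed

text \<open>The quotient \<open>f z / z\<close> tends to \<open>deriv f 0\<close>; restrict to the
  positive axis and take real parts.\<close>

lemma analytic_zero_imp_bigo:
  assumes "f analytic_on {0}" "f 0 = 0" "eventually (\<lambda>s. f (of_real s) = of_real (\<phi> s)) (at_right 0)"
  shows "\<phi> \<in> O[at_right 0](\<lambda>s. s)"
proof (rule bigoI_tendsto)
  have "(f has_field_derivative deriv f 0) (at 0)"
    using assms(1) analytic_at holomorphic_derivI by blast
  then have lim: "((\<lambda>z. f z / z) \<longlongrightarrow> deriv f 0) (at 0)"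
    using assms(2) by (simp add: DERIV_def)
  have "filterlim complex_of_real (at 0) (at_right 0)"
    unfolding filterlim_at by (auto intro!: tendsto_eq_intros eventually_at_right_less [THEN eventually_mono])
  from filterlim_compose [OF lim this]
  have "((\<lambda>s. Re (f (of_real s) / of_real s)) \<longlongrightarrow> Re (deriv f 0)) (at_right 0)"
    by (intro tendsto_Re)
  moreover have "eventually (\<lambda>s. Re (f (of_real s) / of_real s) = \<phi> s / s) (at_right 0)"
    using assms(3) by eventually_elim (simp flip: of_real_divide)
  ultimately show "((\<lambda>s. \<phi> s / s) \<longlongrightarrow> Re (deriv f 0)) (at_right 0)"
    by (rule Lim_transform_eventually)
  show "eventually (\<lambda>s::real. s \<noteq> 0) (at_right 0)"
    by (auto intro: eventually_at_right_less [THEN eventually_mono])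
qed

lemma gamQ_sub_one_bigo:
  assumes "\<phi> \<in> O[at_right 0](\<lambda>s. s)" "eventually (\<lambda>s. 0 \<le> \<phi> s) (at_right 0)"
  shows "(\<lambda>s. gamQ k (\<phi> s) - 1) \<in> O[at_right 0](\<lambda>s::real. s ^ Suc k)"
proof -
  have "(\<lambda>s. gamQ k (\<phi> s) - 1) \<in> O[at_right 0](\<lambda>s. \<phi> s ^ Suc k)"
  proof (rule bigoI [of _ 1])
    show "eventually (\<lambda>s. norm (gamQ k (\<phi> s) - 1) \<le> 1 * norm (\<phi> s ^ Suc k)) (at_right 0)"
      using assms(2) by eventually_elim (use gamQ_sub_one_bound in \<open>auto simp: power_abs simp del: power_Suc\<close>)
  qed
  also have "(\<lambda>s. \<phi> s ^ Suc k) \<in> O[at_right 0](\<lambda>s. s ^ Suc k)"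
    using assms(1) by (rule landau_o.big_power)
  finally show ?thesis .
qed

lemma analytic_on_poly: "poly q analytic_on A" for q :: "complex poly"
  by (induction q) (auto intro!: analytic_intros)

lemma eventually_nhds_isCont_pos:
  fixes f :: "real \<Rightarrow> real"
  assumes "isCont f a" "0 < f a"
  shows "eventually (\<lambda>x. 0 < f x) (nhds a)"
  using assms order_tendstoD(1) [of f "f a" "at a" 0] by (simp add: isCont_def eventually_nhds_conv_at)

text \<open>The identity \<open>ln (g y) = c * ln (f y)\<close> holds only where \<open>y\<close>
  and \<open>f y\<close> are positive, which is a neighbourhood of \<open>x\<close>.\<close>

lemma deriv_ln_powr:
  fixes f :: "real \<Rightarrow> real"
  assumes "(f has_field_derivative D) (at x)" "0 < f x" "0 < x"
    and "\<And>y. 0 < y \<Longrightarrow> g y = f y powr c"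
  shows "deriv (\<lambda>y. ln (g y)) x = c * (D / f x)"
proof (rule DERIV_imp_deriv)
  have "eventually (\<lambda>y. 0 < f y) (nhds x)"
    using assms(1,2) DERIV_isCont order_tendstoD(1) isCont_def tendsto_at_iff_tendsto_nhds by metis
  moreover have "eventually (\<lambda>y. 0 < y) (nhds x)"
    using assms(3) by (simp add: eventually_nhds_in_open [of "{0<..}"] flip: greaterThan_iff)
  ultimately have "eventually (\<lambda>y. ln (g y) = c * ln (f y)) (nhds x)"
    by eventually_elim (auto simp: assms(4) ln_powr)
  moreover have "((\<lambda>y. c * ln (f y)) has_field_derivative c * (D / f x)) (at x)"
    using assms(1,2) by (auto intro!: derivative_eq_intros)
  ultimately show "((\<lambda>y. ln (g y)) has_field_derivative c * (D / f x)) (at x)"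
    by (subst DERIV_cong_ev [OF refl _ refl])
qed

section \<open>Asymptotics at the origin\<close>

text \<open>A truncated series can be evaluated, so congruences modulo a power of \<open>X\<close>
  become \<open>O\<close> bounds on values.\<close>

definition fps_trunc :: "nat \<Rightarrow> 'a::comm_semiring_1 fps \<Rightarrow> 'a poly" where
  "fps_trunc n F = (\<Sum>k\<le>n. monom (fps_nth F k) k)"

lemma coeff_fps_trunc: "coeff (fps_trunc n F) i = (if i \<le> n then fps_nth F i else 0)"
  by (simp add: fps_trunc_def coeff_sum if_distrib cong: if_cong)

lemma poly_fps_trunc: "poly (fps_trunc n F) x = (\<Sum>i\<le>n. fps_nth F i * x ^ i)"
  by (simp add: fps_trunc_def poly_sum poly_monom)

lemma coeff_fps_trunc_mult:
  "i \<le> n \<Longrightarrow> coeff (fps_trunc n F * fps_trunc n G) i = coeff (fps_trunc n (F * G)) i"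
  by (auto simp: coeff_mult coeff_fps_trunc fps_mult_nth atLeast0AtMost intro!: sum.cong)

lemma power_bigo_at_right_0: "n \<le> k \<Longrightarrow> (\<lambda>s::real. s ^ k) \<in> O[at_right 0](\<lambda>s. s ^ n)"
proof (rule bigoI [of _ 1])
  assume "n \<le> k"
  have "eventually (\<lambda>s::real. 0 < s \<and> s < 1) (at_right 0)"
    by (auto simp: eventually_at_right_field intro!: exI [of _ 1])
  then show "eventually (\<lambda>s::real. norm (s ^ k) \<le> 1 * norm (s ^ n)) (at_right 0)"
    by eventually_elim (use \<open>n \<le> k\<close> in \<open>auto simp: power_decreasing\<close>)
qed

lemma poly_square_bigo:
  fixes D :: "real poly"
  assumes "\<And>i. i \<le> n \<Longrightarrow> coeff D i = 0"
  shows "(\<lambda>s. poly D (s\<^sup>2)) \<in> O[at_right 0](\<lambda>s. s ^ Suc n)"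
  unfolding poly_altdef
proof (rule big_sum_in_bigo)
  fix i
  show "(\<lambda>s. coeff D i * (s\<^sup>2) ^ i) \<in> O[at_right 0](\<lambda>s. s ^ Suc n)"
  proof (cases "i \<le> n")
    case False
    then have "(\<lambda>s::real. s ^ (2 * i)) \<in> O[at_right 0](\<lambda>s. s ^ Suc n)"
      by (intro power_bigo_at_right_0) auto
    then show ?thesis
      by (simp add: power_mult [symmetric] del: power_Suc)
  qed (simp add: assms)
qed

lemma poly_square_tendsto: "((\<lambda>s. poly D (s\<^sup>2)) \<longlongrightarrow> poly D 0) (at_right (0::real))"
proof -
  have "((\<lambda>s::real. s\<^sup>2) \<longlongrightarrow> 0\<^sup>2) (at_right 0)"
    by (intro tendsto_intros)
  then show ?thesis
    by (intro tendsto_intros) simp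
qed

lemma tendsto_imp_bigo_1: "(f \<longlongrightarrow> (c::real)) F \<Longrightarrow> f \<in> O[F](\<lambda>_. 1::real)"
  by (rule bigoI_tendsto [of _ _ c]) auto

lemma bigo_mult_bounded:
  fixes f g h :: "real \<Rightarrow> real"
  assumes "f \<in> O[F](h)" "g \<in> O[F](\<lambda>_. 1)"
  shows "(\<lambda>s. f s * g s) \<in> O[F](h)" "(\<lambda>s. g s * f s) \<in> O[F](h)"
  using landau_o.big.mult [OF assms] landau_o.big.mult [OF assms(2,1)] by simp_all

lemma bigo_id_tendsto_0:
  fixes f :: "real \<Rightarrow> real"
  assumes "f \<in> O[at_right 0](\<lambda>s. s)"
  shows "(f \<longlongrightarrow> 0) (at_right 0)"
proof -
  have "((\<lambda>s::real. s / 1) \<longlongrightarrow> 0 / 1) (at_right 0)"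
    by (intro tendsto_intros) auto
  then have "(\<lambda>s::real. s) \<in> o[at_right 0](\<lambda>_. 1)"
    by (intro smalloI_tendsto) auto
  from landau_o.big_small_trans [OF assms this] show ?thesis
    using smalloD_tendsto by fastforce
qed

section \<open>The norm and its logarithmic derivatives\<close>

text \<open>The list \<open>as\<close> of roots is fixed along with \<open>p\<close>, because the
  monotonicity of \<open>G\<close> is read off from its partial fractions.\<close>

locale nonneg_rooted =
  fixes m d :: nat and p :: "real poly" and as :: "real list"
  assumes d_ge_1: "1 \<le> d" and d_le_m: "d \<le> m" and degree_p: "degree p = d" and lead_p: "lead_coeff p = 1"
    and p_eq: "p = (\<Prod>a\<leftarrow>as. [:- a, 1:])" and as_nonneg: "\<And>a. a \<in> set as \<Longrightarrow> 0 \<le> a"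
begin

abbreviation "\<rho> \<equiv> sqrt (Rroot p)"
abbreviation "q \<equiv> sqrt (real m * real d)"
abbreviation "e \<equiv> m - d"

lemma as_nonempty: "as \<noteq> []"
  using degree_p d_ge_1 p_eq by auto

lemma Rroot_eq: "Rroot p = Max (set as)"
proof -
  have "{x. poly p x = 0} = set as"
    by (auto simp: p_eq poly_prod_list_linear prod_list_zero_iff)
  then show ?thesis by (simp add: Rroot_def)
qed

lemma le_Rroot: "a \<in> set as \<Longrightarrow> a \<le> Rroot p"
  by (simp add: Rroot_eq)

lemma Rroot_in: "Rroot p \<in> set as"
  by (simp add: Rroot_eq as_nonempty)

lemma Rroot_nonneg: "0 \<le> Rroot p"
  using Rroot_in as_nonneg by blast

lemma poly_Rroot: "poly p (Rroot p) = 0"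
  using Rroot_in by (auto simp: p_eq poly_prod_list_linear prod_list_zero_iff)

lemma poly_pos: "Rroot p < x \<Longrightarrow> 0 < poly p x"
proof -
  assume "Rroot p < x"
  then have "0 < x - a" if "a \<in> set as" for a
    using le_Rroot [OF that] by simp
  then have "0 < (\<Prod>a\<leftarrow>as. x - a)"
    by (induction as) auto
  then show "0 < poly p x"
    by (simp add: p_eq poly_prod_list_linear)
qed

lemma poly_nonneg: "Rroot p \<le> x \<Longrightarrow> 0 \<le> poly p x"
  using poly_pos [of x] poly_Rroot by (cases "x = Rroot p") auto

lemma q_pos: "0 < q"
  using d_ge_1 d_le_m by simp

lemma rho_nonneg: "0 \<le> \<rho>"
  using Rroot_nonneg by simp

lemma pos_of_rho: "\<rho> < x \<Longrightarrow> 0 < x"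
  using rho_nonneg by linarith

lemma less_square: "\<rho> < x \<Longrightarrow> a \<in> set as \<Longrightarrow> a < x\<^sup>2"
  using le_Rroot Rroot_nonneg
  by (metis order_le_less_trans real_less_rsqrt real_sqrt_ge_zero real_sqrt_less_iff real_sqrt_unique less_imp_le)

section \<open>Monotonicity of \<open>G\<close> and \<open>H\<close>, and the inverse
  \<open>J\<close>\<close>

lemma Gfun_eq:
  assumes "\<rho> < x"
  shows "Gfun d p x = (1 / real d) * (\<Sum>a\<leftarrow>as. x / (x\<^sup>2 - a))"
proof -
  have "x\<^sup>2 \<notin> set as"
    using less_square [OF assms] by blast
  from pderiv_over_poly_prod_list_linear [OF this]
  have "poly (pderiv p) (x\<^sup>2) / poly p (x\<^sup>2) = (\<Sum>a\<leftarrow>as. 1 / (x\<^sup>2 - a))"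
    by (simp add: p_eq)
  moreover have "Gfun d p x = (1 / real d) * (x * (poly (pderiv p) (x\<^sup>2) / poly p (x\<^sup>2)))"
    by (simp add: Gfun_def)
  ultimately show ?thesis
    by (simp flip: sum_list_const_mult)
qed

lemma Gfun_pos: "\<rho> < x \<Longrightarrow> 0 < Gfun d p x"
  using sum_list_strict_mono_real [OF as_nonempty, of "\<lambda>_. 0" "\<lambda>a. x / (x\<^sup>2 - a)"] less_square [of x] rho_nonneg d_ge_1
  by (simp add: Gfun_eq)

lemma Gfun_decreasing:
  assumes "\<rho> < x" "x < y"
  shows "Gfun d p y < Gfun d p x"
proof -
  have "y / (y\<^sup>2 - a) < x / (x\<^sup>2 - a)" if "a \<in> set as" for a
  proof -
    have "a < x\<^sup>2" "a < y\<^sup>2" "0 \<le> a"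
      using assms that less_square [of x] less_square [of y] as_nonneg by auto
    \<comment> \<open>This product is the numerator of \<open>x / (x^2 - a) - y / (y^2 - a)\<close>
      over the common denominator.\<close>
    moreover have "0 < (y - x) * (x * y + a)"
      using assms pos_of_rho [of x] pos_of_rho [of y] \<open>0 \<le> a\<close> by (intro mult_pos_pos add_pos_nonneg) auto
    ultimately show ?thesis
      by (simp add: divide_simps) (simp add: algebra_simps power2_eq_square)
  qed
  from sum_list_strict_mono_real [OF as_nonempty this] show ?thesis
    using assms d_ge_1 by (simp add: Gfun_eq divide_strict_right_mono)
qed

lemma lam_bounds: "0 < lam m d" "lam m d \<le> 1"
  using d_ge_1 d_le_m by (auto simp: lam_def)

text \<open>Both factors of \<open>H\<close> are strictly decreasing. The strictness of the second
  comes from its \<open>G\<close> term, as the term in \<open>1 / x\<close> vanishes when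
  \<open>d = m\<close>.\<close>

lemma Hfun_decreasing:
  assumes "\<rho> < x" "x < y"
  shows "Hfun m d p y < Hfun m d p x"
  unfolding Hfun_def
proof (rule mult_strict_mono)
  show "Gfun d p y < Gfun d p x" by (rule Gfun_decreasing) fact+
  have "lam m d * Gfun d p y < lam m d * Gfun d p x"
    using \<open>Gfun d p y < Gfun d p x\<close> lam_bounds by simp
  moreover have "(1 - lam m d) / y \<le> (1 - lam m d) / x"
    using assms lam_bounds pos_of_rho [of x] pos_of_rho [of y] by (intro divide_left_mono mult_pos_pos) auto
  ultimately show "lam m d * Gfun d p y + (1 - lam m d) / y < lam m d * Gfun d p x + (1 - lam m d) / x"
    by simp
  show "0 < Gfun d p x" using assms Gfun_pos by simp
  have "0 \<le> lam m d * Gfun d p y" "0 \<le> (1 - lam m d) / y"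
    using assms Gfun_pos [of y] lam_bounds pos_of_rho [of y] by auto
  then show "0 \<le> lam m d * Gfun d p y + (1 - lam m d) / y" by simp
qed

text \<open>Strict monotonicity makes the described \<open>z\<close> unique; for small
  \<open>s\<close> such a \<open>z\<close> is exhibited in
  \<open>zfun_inverse_analytic\<close>.\<close>

lemma Jfun_eqI: "\<rho> < z \<Longrightarrow> Hfun m d p z = u \<Longrightarrow> Jfun m d p u = z"
  unfolding Jfun_def
  by (rule the_equality) (auto, metis Hfun_decreasing linorder_less_linear order_less_irrefl)

text \<open>Laplace transform of \<open>x ^ a * y ^ (e + b) * p (x y)\<close> over \<open>X\<close>.\<close>
definition lap :: "nat \<Rightarrow> nat \<Rightarrow> real \<Rightarrow> real \<Rightarrow> real" where
  "lap a b u v = (\<Sum>j\<le>d. coeff p j * (tail_moment \<rho> (j + a) u * tail_moment \<rho> (j + e + b) v))"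

text \<open>Raising to the power \<open>q\<close> cancels the exponents \<open>(m - d) / q\<close>
  and \<open>1 / q\<close> of \<open>Delta\<close>, which leaves the Laplace integral of
  \<open>y ^ e * poly p (x * y)\<close>.\<close>

lemma Nfun_eq:
  assumes "0 < r" "0 < t"
  shows "Nfun m d p r t = lap 0 0 (q * r) (q * t) powr (1 / q)"
proof -
  have "(exp (- x * r - y * t) * Delta m d p x y) powr q
      = exp (- (q * r * x)) * exp (- (q * t * y)) * y ^ e * poly p (x * y)" 
    if "\<rho> \<le> x" "\<rho> \<le> y" for x y
  proof (cases "poly p (x * y) = 0")
    case False
    have "\<rho> * \<rho> \<le> x * y"
      using that rho_nonneg by (intro mult_mono order_trans [OF rho_nonneg that(1)])
    then have xy: "Rroot p \<le> x * y"
      using Rroot_nonneg by simp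
    then have pos: "0 < poly p (x * y)"
      using poly_nonneg False by force
    \<comment> \<open>If \<open>y = 0\<close>, then \<open>xy\<close> forces the largest root to be
      0, so \<open>poly p (x * y)\<close> vanishes. Excluding this case matters because
      \<open>0 powr 0\<close> is 0 while \<open>0 ^ 0\<close> is 1.\<close>
    have "y \<noteq> 0"
      using that False poly_Rroot xy Rroot_nonneg rho_nonneg by fastforce
    then have "0 < y"
      using that rho_nonneg by linarith
    have "(y powr ((real m - real d) / q)) powr q = y ^ e"
      using d_ge_1 \<open>0 < y\<close> d_le_m by (simp add: powr_powr powr_realpow flip: of_nat_diff)
    moreover have "(poly p (x * y) powr (1 / q)) powr q = poly p (x * y)"
      using d_ge_1 d_le_m pos by (simp add: powr_powr)
    moreover have "exp (- x * r - y * t) powr q = exp (- (q * r * x)) * exp (- (q * t * y))"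
      by (simp add: powr_def algebra_simps flip: exp_add)
    ultimately show ?thesis
      by (simp add: Delta_def powr_mult)
  qed (simp add: Delta_def)
  then have "integral (Xset p) (\<lambda>(x, y). (exp (- x * r - y * t) * Delta m d p x y) powr q)
     = integral ({\<rho>..} \<times> {\<rho>..}) (\<lambda>(x, y). exp (- (q * r * x)) * exp (- (q * t * y)) * y ^ e * poly p (x * y))"
    unfolding Xset_def by (intro integral_cong) auto
  also have "\<dots> = lap 0 0 (q * r) (q * t)"
    using integral_poly_tail_moment [of \<rho> "q * r" "q * t" e p] rho_nonneg q_pos assms degree_p
    by (simp add: lap_def)
  finally show ?thesis
    by (simp add: Nfun_def qnorm_def)
qed

text \<open>The factor \<open>q\<close> from the inner derivative cancels the exponent
  \<open>1 / q\<close> of the norm.\<close>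

lemma deriv_ln_Nfun:
  assumes "0 < r" "0 < t" "0 < lap 0 0 (q * r) (q * t)"
  shows "deriv (\<lambda>r. ln (Nfun m d p r t)) r = - lap 1 0 (q * r) (q * t) / lap 0 0 (q * r) (q * t)"
    and "deriv (\<lambda>t. ln (Nfun m d p r t)) t = - lap 0 1 (q * r) (q * t) / lap 0 0 (q * r) (q * t)"
proof -
  have "((\<lambda>r. lap 0 0 (q * r) (q * t)) has_field_derivative - q * lap 1 0 (q * r) (q * t)) (at r)"
    unfolding lap_def using assms q_pos
    by (auto intro!: derivative_eq_intros DERIV_tail_moment sum.cong simp: sum_distrib_left sum_negf [symmetric])
  from deriv_ln_powr [OF this, of "\<lambda>r. Nfun m d p r t" "1 / q"]
  show "deriv (\<lambda>r. ln (Nfun m d p r t)) r = - lap 1 0 (q * r) (q * t) / lap 0 0 (q * r) (q * t)"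
    using assms q_pos by (simp add: Nfun_eq del: real_sqrt_gt_0_iff real_sqrt_eq_0_iff mult_eq_0_iff)
  have "((\<lambda>t. lap 0 0 (q * r) (q * t)) has_field_derivative - q * lap 0 1 (q * r) (q * t)) (at t)"
    unfolding lap_def using assms q_pos
    by (auto intro!: derivative_eq_intros DERIV_tail_moment sum.cong simp: sum_distrib_left sum_negf [symmetric])
  from deriv_ln_powr [OF this, of "\<lambda>t. Nfun m d p r t" "1 / q"]
  show "deriv (\<lambda>t. ln (Nfun m d p r t)) t = - lap 0 1 (q * r) (q * t) / lap 0 0 (q * r) (q * t)"
    using assms q_pos by (simp add: Nfun_eq del: real_sqrt_gt_0_iff real_sqrt_eq_0_iff mult_eq_0_iff)
qed

section \<open>Analytic dependence on the parameter\<close>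

text \<open>The function \<open>G\<close> near infinity: \<open>G (1 / w) = w * gR (w^2)\<close>.
  Reversed polynomials make \<open>gR\<close> regular at 0; \<open>gC\<close> is its complex
  extension.\<close>

definition gR :: "real \<Rightarrow> real" where
  "gR v = poly (reflect_poly (pderiv p)) v / (real d * poly (reflect_poly p) v)"

definition gC :: "complex \<Rightarrow> complex" where
  "gC v = poly (map_poly of_real (reflect_poly (pderiv p))) v
            / (of_nat d * poly (map_poly of_real (reflect_poly p)) v)"

lemma gC_of_real: "gC (of_real v) = of_real (gR v)"
  by (simp add: gC_def gR_def of_real_poly)

lemma lead_coeff_pderiv_p: "lead_coeff (pderiv p) = real d"
  using lead_p degree_p d_ge_1 by (simp add: degree_pderiv coeff_pderiv)

lemma gR_0 [simp]: "gR 0 = 1"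
  using lead_p lead_coeff_pderiv_p d_ge_1 by (simp add: gR_def)

lemma gC_0 [simp]: "gC 0 = 1"
  using gC_of_real [of 0] by simp

lemma analytic_gC: "gC analytic_on {0}"
proof -
  have "poly (map_poly of_real (reflect_poly p)) (0::complex) = 1"
    using of_real_poly [of "reflect_poly p" 0] lead_p by simp
  then show ?thesis
    unfolding gC_def [abs_def] using d_ge_1
    by (intro analytic_intros analytic_on_poly) auto
qed

lemma isCont_gR: "isCont gR 0"
  unfolding gR_def [abs_def] using lead_p d_ge_1 by (intro continuous_intros) auto

lemma Gfun_inverse:
  assumes "0 < w"
  shows "Gfun d p (1 / w) = w * gR (w\<^sup>2)"
proof -
  define P P' where "P = poly p (1 / w\<^sup>2)" and "P' = poly (pderiv p) (1 / w\<^sup>2)"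
  have "poly (reflect_poly p) (w\<^sup>2) = (w\<^sup>2) ^ d * P"
    using assms degree_p by (simp add: poly_reflect_poly_nz inverse_eq_divide P_def)
  also have "(w\<^sup>2) ^ d = w\<^sup>2 * (w\<^sup>2) ^ (d - 1)"
    using d_ge_1 by (cases d) auto
  finally have "poly (reflect_poly p) (w\<^sup>2) = w\<^sup>2 * (w\<^sup>2) ^ (d - 1) * P" .
  moreover have "poly (reflect_poly (pderiv p)) (w\<^sup>2) = (w\<^sup>2) ^ (d - 1) * P'"
    using assms degree_p by (simp add: poly_reflect_poly_nz inverse_eq_divide P'_def degree_pderiv)
  ultimately have "gR (w\<^sup>2) = P' / (real d * w\<^sup>2 * P)"
    using assms unfolding gR_def by (simp add: divide_simps)
  moreover have "Gfun d p (1 / w) = P' / (real d * w * P)"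
    by (simp add: Gfun_def P_def P'_def power_one_over mult_ac)
  ultimately show ?thesis
    using assms by (simp add: power2_eq_square)
qed

text \<open>The factor left after taking \<open>w^2\<close> out of \<open>H (1 / w)\<close>. Its
  value 1 at 0 keeps the square root in \<open>hC\<close> analytic.\<close>

definition kR :: "real \<Rightarrow> real" where
  "kR v = gR v * (lam m d * gR v + (1 - lam m d))"

definition kC :: "complex \<Rightarrow> complex" where
  "kC v = gC v * (of_real (lam m d) * gC v + of_real (1 - lam m d))"

lemma kC_of_real: "kC (of_real v) = of_real (kR v)"
  by (simp add: kC_def kR_def gC_of_real)

lemma kR_0 [simp]: "kR 0 = 1"
  by (simp add: kR_def)

lemma kC_0 [simp]: "kC 0 = 1"
  using kC_of_real [of 0] by simp

lemma Hfun_inverse: "0 < w \<Longrightarrow> Hfun m d p (1 / w) = w\<^sup>2 * kR (w\<^sup>2)"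
  by (simp add: Hfun_def Gfun_inverse kR_def power2_eq_square algebra_simps)

text \<open>By \<open>Hfun_inverse\<close>, the local inverse of \<open>hC\<close> sends \<open>s\<close> to \<open>1 / z\<close>.\<close>
definition hC :: "complex \<Rightarrow> complex" where
  "hC w = w * csqrt (kC (w\<^sup>2))"

lemma analytic_kC_sq: "(\<lambda>w. kC (w\<^sup>2)) analytic_on {0}" and analytic_gC_sq: "(\<lambda>w. gC (w\<^sup>2)) analytic_on {0}"
proof -
  show g: "(\<lambda>w. gC (w\<^sup>2)) analytic_on {0}"
    by (rule analytic_on_compose [of "\<lambda>w. w\<^sup>2" "{0}" gC, unfolded o_def])
      (auto intro!: analytic_intros analytic_gC)
  show "(\<lambda>w. kC (w\<^sup>2)) analytic_on {0}"
    unfolding kC_def by (intro analytic_intros g)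
qed

lemma analytic_csqrt_kC: "(\<lambda>w. csqrt (kC (w\<^sup>2))) analytic_on {0}"
  by (intro analytic_on_csqrt' analytic_kC_sq) auto

lemma analytic_hC: "hC analytic_on {0}"
  unfolding hC_def [abs_def] by (intro analytic_intros analytic_csqrt_kC)

lemma deriv_hC: "deriv hC 0 = 1"
proof (rule DERIV_imp_deriv)
  have "((\<lambda>w. csqrt (kC (w\<^sup>2))) has_field_derivative deriv (\<lambda>w. csqrt (kC (w\<^sup>2))) 0) (at 0)"
    using analytic_csqrt_kC analytic_at holomorphic_derivI by blast
  then show "(hC has_field_derivative 1) (at 0)"
    using DERIV_mult [OF DERIV_ident] by (fastforce simp: hC_def [abs_def])
qed

lemma eventually_kR_pos: "eventually (\<lambda>w. 0 < kR (w\<^sup>2)) (nhds 0)"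
proof (rule eventually_nhds_isCont_pos)
  have "isCont (\<lambda>w. gR (w\<^sup>2)) 0"
    by (rule isCont_o2 [of 0 "\<lambda>w. w\<^sup>2" gR]) (auto intro: isCont_gR)
  then show "isCont (\<lambda>w. kR (w\<^sup>2)) 0"
    unfolding kR_def by (intro continuous_intros)
qed simp

lemma eventually_reflect_pos: "eventually (\<lambda>w. 0 < poly (reflect_poly p) (w\<^sup>2)) (nhds 0)"
  using lead_p by (intro eventually_nhds_isCont_pos continuous_intros) auto

text \<open>The intermediate value theorem produces a real \<open>w\<close> with
  \<open>w * sqrt (kR (w^2)) = s\<close>. The local inverse of \<open>hC\<close> then identifies
  \<open>w\<close> with \<open>\<omega> s\<close>, and monotonicity of \<open>H\<close> identifies
  \<open>1 / w\<close> with \<open>z\<close>.\<close>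

lemma zfun_inverse_analytic:
  "\<exists>\<omega>. \<omega> analytic_on {0} \<and> \<omega> 0 = 0 \<and>
     eventually (\<lambda>s. \<exists>w>0. \<omega> (of_real s) = of_real w \<and> zfun m d p s = 1 / w \<and>
        \<rho> < 1 / w \<and> Hfun m d p (1 / w) = s\<^sup>2) (at_right 0)"
proof -
  obtain \<omega> where \<omega>: "\<omega> analytic_on {0}" "\<omega> 0 = 0" "eventually (\<lambda>z. \<omega> (hC z) = z) (nhds 0)"
    using analytic_local_inverse [OF analytic_hC] deriv_hC by (auto simp: hC_def)
  have "eventually (\<lambda>w. \<omega> (hC (of_real w)) = of_real w) (nhds 0)"
    using \<omega>(3) by (rule eventually_compose_filterlim) (auto intro!: tendsto_eq_intros filterlim_ident)
  moreover have "((\<lambda>w. w * \<rho>) \<longlongrightarrow> 0 * \<rho>) (nhds 0)"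
    by (intro tendsto_intros filterlim_ident)
  then have "eventually (\<lambda>w. w * \<rho> < 1) (nhds 0)"
    by (rule order_tendstoD) auto
  ultimately have "eventually (\<lambda>w. \<omega> (hC (of_real w)) = of_real w \<and> w * \<rho> < 1 \<and> 0 < kR (w\<^sup>2)
       \<and> 0 < poly (reflect_poly p) (w\<^sup>2)) (nhds 0)"
    using eventually_kR_pos eventually_reflect_pos by eventually_elim blast
  then obtain \<delta> where "0 < \<delta>" and \<delta>: "\<And>w. \<bar>w\<bar> < \<delta> \<Longrightarrow> \<omega> (hC (of_real w)) = of_real w \<and> w * \<rho> < 1 \<and> 0 < kR (w\<^sup>2) \<and> 0 < poly (reflect_poly p) (w\<^sup>2)"
    by (auto simp: eventually_nhds_metric dist_real_def)
  \<comment> \<open>Half of \<open>\<delta>\<close> keeps the closed interval from 0 to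
    \<open>c\<close> inside the range where all four conditions hold.\<close>
  define c where "c = \<delta> / 2"
  define hR where "hR w = w * sqrt (kR (w\<^sup>2))" for w
  have c: "0 < c" "c < \<delta>"
    using \<open>0 < \<delta>\<close> by (auto simp: c_def)
  have nz: "\<forall>w\<in>{0..c}. real d * poly (reflect_poly p) (w\<^sup>2) \<noteq> 0"
  proof
    fix w assume "w \<in> {0..c}"
    then show "real d * poly (reflect_poly p) (w\<^sup>2) \<noteq> 0"
      using \<delta> [of w] c d_ge_1 by simp
  qed
  have cont: "continuous_on {0..c} hR"
    unfolding hR_def kR_def gR_def by (intro continuous_intros nz)
  have "0 < hR c"
    using c \<delta> [of c] by (auto simp: hR_def)
  have "\<exists>w>0. \<omega> (of_real s) = of_real w \<and> zfun m d p s = 1 / w \<and> \<rho> < 1 / w \<and> Hfun m d p (1 / w) = s\<^sup>2"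
    if s: "0 < s" "s < hR c" for s
  proof -
    have "hR 0 = 0" by (simp add: hR_def)
    then obtain w where w: "0 \<le> w" "w \<le> c" "hR w = s"
      using IVT' [of hR 0 s c] s c cont by auto
    with s \<open>hR 0 = 0\<close> have "0 < w" by (cases "w = 0") auto
    have k: "0 < kR (w\<^sup>2)" "\<omega> (hC (of_real w)) = of_real w" "w * \<rho> < 1"
      using \<delta> [of w] w c by auto
    have "hC (of_real w) = of_real s"
      using k(1) by (simp add: hC_def kC_of_real csqrt_of_real_nonneg hR_def flip: of_real_power w(3))
    then have "\<omega> (of_real s) = of_real w"
      using k by simp
    moreover have "\<rho> < 1 / w"
      using k(3) \<open>0 < w\<close> by (simp add: field_simps)
    moreover have "Hfun m d p (1 / w) = s\<^sup>2"
      using k(1) \<open>0 < w\<close> by (simp add: Hfun_inverse hR_def power_mult_distrib flip: w(3))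
    ultimately show ?thesis
      using \<open>0 < w\<close> Jfun_eqI by (auto simp: zfun_def)
  qed
  then have "eventually (\<lambda>s. \<exists>w>0. \<omega> (of_real s) = of_real w \<and> zfun m d p s = 1 / w \<and>
        \<rho> < 1 / w \<and> Hfun m d p (1 / w) = s\<^sup>2) (at_right 0)"
    using \<open>0 < hR c\<close> eventually_at_right_field by blast
  with \<omega> show ?thesis by blast
qed

text \<open>With \<open>w = 1 / z\<close>, both \<open>r = (d / q) * G z\<close> and
  \<open>t = r + ((m - d) / q) * w\<close> are analytic in \<open>w = \<omega> s\<close>, and since
  \<open>q^2 = m d\<close> their product is \<open>H z = s^2\<close>.\<close>

lemma rfun_tfun_analytic:
  "\<exists>rC tC. rC analytic_on {0} \<and> tC analytic_on {0} \<and> rC 0 = 0 \<and> tC 0 = 0 \<and>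
     eventually (\<lambda>s. rC (of_real s) = of_real (rfun m d p s) \<and> tC (of_real s) = of_real (tfun m d p s) \<and>
        0 < rfun m d p s \<and> 0 < tfun m d p s \<and> rfun m d p s * tfun m d p s = s\<^sup>2) (at_right 0)"
proof -
  obtain \<omega> where \<omega>: "\<omega> analytic_on {0}" "\<omega> 0 = 0"
    "eventually (\<lambda>s. \<exists>w>0. \<omega> (of_real s) = of_real w \<and> zfun m d p s = 1 / w \<and>
        \<rho> < 1 / w \<and> Hfun m d p (1 / w) = s\<^sup>2) (at_right 0)"
    using zfun_inverse_analytic by blast
  define rC where "rC s = of_real (real d / q) * (\<omega> s * gC ((\<omega> s)\<^sup>2))" for s
  define tC where "tC s = rC s + of_real ((real m - real d) / q) * \<omega> s" for s
  have g: "(\<lambda>s. gC ((\<omega> s)\<^sup>2)) analytic_on {0}"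
    by (rule analytic_on_compose [of \<omega> "{0}" "\<lambda>w. gC (w\<^sup>2)", unfolded o_def])
      (use \<omega> analytic_gC_sq in auto)
  have r: "rC analytic_on {0}"
    unfolding rC_def [abs_def] by (intro analytic_intros g \<omega>)
  have t: "tC analytic_on {0}"
    unfolding tC_def [abs_def] by (intro analytic_intros r \<omega>)
  have "eventually (\<lambda>s. rC (of_real s) = of_real (rfun m d p s) \<and> tC (of_real s) = of_real (tfun m d p s) \<and>
        0 < rfun m d p s \<and> 0 < tfun m d p s \<and> rfun m d p s * tfun m d p s = s\<^sup>2) (at_right 0)"
    using \<omega>(3)
  proof eventually_elim
    case (elim s)
    then obtain w where w: "0 < w" "\<omega> (of_real s) = of_real w" "zfun m d p s = 1 / w"
        "\<rho> < 1 / w" "Hfun m d p (1 / w) = s\<^sup>2"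
      by blast
    have "rfun m d p s = real d / q * Gfun d p (1 / w)"
      using d_ge_1 by (simp add: rfun_def Let_def w(3) Gfun_def)
    then have rG: "rfun m d p s = real d / q * Gfun d p (1 / w)" "0 < rfun m d p s"
      using Gfun_pos [OF w(4)] q_pos d_ge_1 by (auto intro!: mult_pos_pos divide_pos_pos simp del: real_sqrt_gt_0_iff)
    have tw: "tfun m d p s = rfun m d p s + (real m - real d) / q * w"
      using w(1) by (simp add: tfun_def w(3))
    moreover have "0 \<le> (real m - real d) / q * w"
      using w(1) d_le_m q_pos by simp
    ultimately have "0 < tfun m d p s"
      using rG(2) by linarith
    have q2: "q * q = real m * real d"
      by simp
    have "rfun m d p s * tfun m d p s = (real d * real d * (Gfun d p (1 / w))\<^sup>2 + real d * (real m - real d) * w * Gfun d p (1 / w)) / (q * q)"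
      unfolding tw rG(1) by (simp add: algebra_simps power2_eq_square add_divide_distrib diff_divide_distrib del: real_sqrt_mult_self)
    also have "\<dots> = Hfun m d p (1 / w)"
      using d_ge_1 d_le_m w(1) unfolding q2 by (simp add: Hfun_def lam_def field_simps power2_eq_square)
    finally have "rfun m d p s * tfun m d p s = s\<^sup>2"
      using w(5) by simp
    moreover have rc: "rC (of_real s) = of_real (rfun m d p s)"
      using Gfun_inverse [OF w(1)] gC_of_real [of "w\<^sup>2"] unfolding rC_def w(2) rG(1) by simp
    moreover have "tC (of_real s) = of_real (tfun m d p s)"
      unfolding tC_def rc w(2) tw by simp
    ultimately show ?case
      using rG(2) \<open>0 < tfun m d p s\<close> by blast
  qed
  moreover have "rC 0 = 0" "tC 0 = 0"
    by (auto simp: rC_def tC_def \<omega>(2))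
  ultimately show ?thesis
    using r t by blast
qed

section \<open>Clearing the poles\<close>

text \<open>\<open>W a b r t\<close> is \<open>lap a b (q r) (q t)\<close> with its pole at \<open>r = t = 0\<close> cleared, so that it is entire.\<close>
definition W :: "nat \<Rightarrow> nat \<Rightarrow> 'a \<Rightarrow> 'a \<Rightarrow> 'a::{real_normed_field,banach}" where
  "W a b r t = (\<Sum>j\<le>d. of_real (coeff p j) * (fact (j + a) * gamQ (j + a) (of_real (\<rho> * q) * r))
      * (fact (j + e + b) * gamQ (j + e + b) (of_real (\<rho> * q) * t)) * (of_real (real m * real d) * (r * t)) ^ (d - j))"

lemma W_of_real: "W a b (of_real r :: complex) (of_real t) = of_real (W a b r t)"
proof -
  have "gamQ k (of_real (\<rho> * q) * of_real x) = (of_real (gamQ k (\<rho> * q * x)) :: complex)" for k x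
    using gamQ_of_real [of k "\<rho> * q * x"] by (simp only: of_real_mult)
  then show ?thesis
    by (simp add: W_def)
qed

lemma analytic_on_W:
  assumes "f analytic_on A" "g analytic_on A"
  shows "(\<lambda>s. W a b (f s) (g s)) analytic_on A"
  unfolding W_def using assms by (intro analytic_intros analytic_on_gamQ)

lemma W_0: "W a b 0 0 = fact (d + a) * fact (m + b)"
proof -
  have "W a b 0 0 = (\<Sum>j\<in>{d}. of_real (coeff p j) * fact (j + a) * fact (j + e + b) * 0 ^ (d - j))"
    unfolding W_def by (rule sum.mono_neutral_cong_right) auto
  then show ?thesis
    using lead_p degree_p d_le_m by simp
qed

lemma W_tendsto:
  fixes f g :: "real \<Rightarrow> real"
  assumes "(f \<longlongrightarrow> 0) F" "(g \<longlongrightarrow> 0) F"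
  shows "((\<lambda>s. W a b (f s) (g s)) \<longlongrightarrow> fact (d + a) * fact (m + b)) F"
proof -
  have [tendsto_intros]: "((\<lambda>s. gamQ k (h s)) \<longlongrightarrow> gamQ k c) F" if "(h \<longlongrightarrow> c) F" for h :: "real \<Rightarrow> real" and c k
    using isCont_tendsto_compose [OF DERIV_isCont [OF has_field_derivative_gamQ] that] .
  have "((\<lambda>s. W a b (f s) (g s)) \<longlongrightarrow> W a b 0 0) F"
    unfolding W_def by (intro tendsto_intros assms)
  then show ?thesis
    by (simp add: W_0)
qed

text \<open>With \<open>u = q r\<close> and \<open>v = q t\<close>, the term of index
  \<open>j\<close> has poles of orders \<open>j + a + 1\<close> in \<open>u\<close> and
  \<open>j + e + b + 1\<close> in \<open>v\<close>. Bringing all terms to the orders of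
  \<open>j = d\<close> leaves \<open>(u * v) ^ (d - j)\<close>.\<close>

lemma lap_eq_W:
  assumes "0 < r" "0 < t"
  shows "lap a b (q * r) (q * t) = W a b r t / ((q * r) ^ Suc (d + a) * (q * t) ^ Suc (m + b))"
proof -
  define u v where "u = q * r" and "v = q * t"
  have uv: "u \<noteq> 0" "v \<noteq> 0"
    using assms d_ge_1 d_le_m by (auto simp: u_def v_def)
  have "real m * real d * (r * t) = u * v" "\<rho> * q * r = \<rho> * u" "\<rho> * q * t = \<rho> * v"
    by (simp_all add: u_def v_def algebra_simps)
  then have "W a b r t = (\<Sum>j\<le>d. coeff p j * (fact (j + a) * gamQ (j + a) (\<rho> * u))
       * (fact (j + e + b) * gamQ (j + e + b) (\<rho> * v)) * (u * v) ^ (d - j))"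
    by (simp only: W_def of_real_eq_id id_apply)
  moreover have "coeff p j * (tail_moment \<rho> (j + a) u * tail_moment \<rho> (j + e + b) v)
      = coeff p j * (fact (j + a) * gamQ (j + a) (\<rho> * u)) * (fact (j + e + b) * gamQ (j + e + b) (\<rho> * v))
         * (u * v) ^ (d - j) / (u ^ Suc (d + a) * v ^ Suc (m + b))" if "j \<le> d" for j
  proof -
    have "u ^ Suc (d + a) = u ^ Suc (j + a) * u ^ (d - j)"
      unfolding power_add [symmetric] using that by (simp add: add.commute)
    moreover have "v ^ Suc (m + b) = v ^ Suc (j + e + b) * v ^ (d - j)"
      unfolding power_add [symmetric] using that d_le_m by (simp add: add.commute)
    ultimately show ?thesis
      using uv by (simp add: tail_moment_def power_mult_distrib field_simps)
  qed
  ultimately show ?thesis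
    unfolding lap_def u_def [symmetric] v_def [symmetric] by (auto simp only: sum_divide_distrib atMost_iff intro!: sum.cong)
qed

text \<open>The two logarithmic derivatives contribute one pole each, \<open>1 / u\<close> and
  \<open>1 / v\<close>, and \<open>u * v = m d s^2\<close> cancels the factor
  \<open>s^2\<close>.\<close>

lemma square_times_Qfun:
  assumes "0 < rfun m d p s" "0 < tfun m d p s" "rfun m d p s * tfun m d p s = s\<^sup>2"
    and "0 < W 0 0 (rfun m d p s) (tfun m d p s)"
  shows "s\<^sup>2 * Qfun m d p s = W 1 0 (rfun m d p s) (tfun m d p s) * W 0 1 (rfun m d p s) (tfun m d p s)
           / (real m * real d * (W 0 0 (rfun m d p s) (tfun m d p s))\<^sup>2)"
proof -
  define r t where "r = rfun m d p s" and "t = tfun m d p s"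
  define u v where "u = q * r" and "v = q * t"
  have rt: "0 < r" "0 < t" "r * t = s\<^sup>2" "0 < W 0 0 r t"
    using assms by (auto simp: r_def t_def)
  have uv: "0 < u" "0 < v"
    using rt d_ge_1 d_le_m by (auto simp: u_def v_def)
  have L: "lap a b u v = W a b r t / (u ^ Suc (d + a) * v ^ Suc (m + b))" for a b
    using lap_eq_W rt by (simp add: u_def v_def)
  have "0 < lap 0 0 u v"
    using rt uv by (simp add: L)
  then have "Qfun m d p s = (- lap 1 0 u v / lap 0 0 u v) * (- lap 0 1 u v / lap 0 0 u v)"
    using deriv_ln_Nfun rt unfolding Qfun_def r_def t_def u_def v_def by simp
  also have "\<dots> = W 1 0 r t * W 0 1 r t / (u * v * (W 0 0 r t)\<^sup>2)"
    using rt uv by (simp add: L field_simps power2_eq_square)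
  also have "u * v = real m * real d * s\<^sup>2"
    by (simp add: u_def v_def algebra_simps flip: rt(3))
  finally have "Qfun m d p s = W 1 0 r t * W 0 1 r t / (real m * real d * s\<^sup>2 * (W 0 0 r t)\<^sup>2)" .
  moreover have "s\<^sup>2 \<noteq> 0"
    unfolding rt(3) [symmetric] using rt(1,2) by simp
  ultimately show ?thesis
    by (simp flip: r_def t_def)
qed

abbreviation rad0 :: real where "rad0 \<equiv> (1 - lam m d)\<^sup>2 / (4 * (lam m d)\<^sup>2)"
abbreviation offset :: real where "offset \<equiv> (lam m d + 1) / (2 * lam m d) + 1 / real d"

text \<open>Dividing by \<open>lam m d\<close> turns the constant \<open>m d\<close> into
  \<open>d^2\<close>.\<close>

lemma Rtilde_eq:
  assumes "0 < rfun m d p s" "0 < tfun m d p s" "rfun m d p s * tfun m d p s = s\<^sup>2"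
    and "0 < W 0 0 (rfun m d p s) (tfun m d p s)"
  shows "Rtilde m d p s = sqrt (W 1 0 (rfun m d p s) (tfun m d p s) * W 0 1 (rfun m d p s) (tfun m d p s)
           / ((real d)\<^sup>2 * (W 0 0 (rfun m d p s) (tfun m d p s))\<^sup>2) + rad0) - offset"
proof -
  have "1 / lam m d * s\<^sup>2 * Qfun m d p s = 1 / lam m d * (s\<^sup>2 * Qfun m d p s)"
    by simp
  also have "\<dots> = W 1 0 (rfun m d p s) (tfun m d p s) * W 0 1 (rfun m d p s) (tfun m d p s)
           / ((real d)\<^sup>2 * (W 0 0 (rfun m d p s) (tfun m d p s))\<^sup>2)"
    unfolding square_times_Qfun [OF assms] using d_ge_1 d_le_m
    by (simp add: lam_def power2_eq_square)
  finally show ?thesis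
    by (simp add: Rtilde_def)
qed

text \<open>What remains of \<open>W\<close> when the region \<open>X\<close> is replaced by the whole quadrant and \<open>r t = x\<close>.\<close>
definition Wlead :: "nat \<Rightarrow> nat \<Rightarrow> real \<Rightarrow> real" where
  "Wlead a b x = (\<Sum>j\<le>d. coeff p j * fact (j + a) * fact (j + e + b) * (real m * real d * x) ^ (d - j))"

text \<open>In the term of index \<open>j\<close> the defects of the \<open>gamQ\<close> factors are
  of order at least \<open>j + 1\<close>, and \<open>(r t) ^ (d - j)\<close> contributes
  \<open>s ^ (2 * (d - j))\<close>; the total \<open>2 d - j + 1\<close> is at least
  \<open>d + 1\<close>.\<close>

lemma W_sub_Wlead_bigo:
  assumes r: "f \<in> O[at_right 0](\<lambda>s. s)" and t: "g \<in> O[at_right 0](\<lambda>s. s)"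
    and ev: "eventually (\<lambda>s. 0 < f s \<and> 0 < g s \<and> f s * g s = s\<^sup>2) (at_right 0)"
  shows "(\<lambda>s. W a b (f s) (g s) - Wlead a b (s\<^sup>2)) \<in> O[at_right 0](\<lambda>s. s ^ Suc d)"
proof -
  define A where "A j s = gamQ (j + a) (\<rho> * q * f s) - 1" for j s
  define B where "B j s = gamQ (j + e + b) (\<rho> * q * g s) - 1" for j s
  have nn: "0 \<le> \<rho> * q"
    using rho_nonneg q_pos by (intro mult_nonneg_nonneg) auto
  have A: "A j \<in> O[at_right 0](\<lambda>s. s ^ Suc (j + a))" for j
    unfolding A_def
  proof (rule gamQ_sub_one_bigo)
    show "eventually (\<lambda>s. 0 \<le> \<rho> * q * f s) (at_right 0)"
      using ev by eventually_elim (intro mult_nonneg_nonneg nn, auto)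
  qed (use r in simp)
  have B: "B j \<in> O[at_right 0](\<lambda>s. s ^ Suc (j + e + b))" for j
    unfolding B_def
  proof (rule gamQ_sub_one_bigo)
    show "eventually (\<lambda>s. 0 \<le> \<rho> * q * g s) (at_right 0)"
      using ev by eventually_elim (intro mult_nonneg_nonneg nn, auto)
  qed (use t in simp)
  have pow: "(\<lambda>s. h s * s ^ (2 * (d - j))) \<in> O[at_right 0](\<lambda>s. s ^ Suc d)"
    if "h \<in> O[at_right 0](\<lambda>s::real. s ^ Suc k)" "j \<le> k" "j \<le> d" for h j k
  proof -
    have "(\<lambda>s. h s * s ^ (2 * (d - j))) \<in> O[at_right 0](\<lambda>s::real. s ^ Suc k * s ^ (2 * (d - j)))"
      using that(1) by (intro landau_o.big.mult) auto
    also have "(\<lambda>s::real. s ^ Suc k * s ^ (2 * (d - j))) \<in> O[at_right 0](\<lambda>s. s ^ Suc d)"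
      unfolding power_add [symmetric] using that by (intro power_bigo_at_right_0) auto
    finally show ?thesis .
  qed
  have bounded: "(\<lambda>s. A j s + 1) \<in> O[at_right 0](\<lambda>_. 1)" for j
  proof -
    have "A j \<in> O[at_right 0](\<lambda>s. s ^ 0)"
      by (rule landau_o.big_trans [OF A power_bigo_at_right_0]) simp
    then show ?thesis by (intro sum_in_bigo) auto
  qed
  \<comment> \<open>The shape comes from
    \<open>(A + 1) * (B + 1) - 1 = A + (A + 1) * B\<close>.\<close>
  have summand: "(\<lambda>s. c * (A j s * s ^ (2 * (d - j)) + (A j s + 1) * (B j s * s ^ (2 * (d - j)))))
     \<in> O[at_right 0](\<lambda>s. s ^ Suc d)" if "j \<le> d" for j c
  proof -
    have "(\<lambda>s. A j s * s ^ (2 * (d - j))) \<in> O[at_right 0](\<lambda>s. s ^ Suc d)"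
      by (rule pow [OF A]) (use that in auto)
    moreover have "(\<lambda>s. B j s * s ^ (2 * (d - j))) \<in> O[at_right 0](\<lambda>s. s ^ Suc d)"
      by (rule pow [OF B]) (use that in auto)
    note bigo_mult_bounded(2) [OF this bounded]
    ultimately have "(\<lambda>s. A j s * s ^ (2 * (d - j)) + (A j s + 1) * (B j s * s ^ (2 * (d - j))))
        \<in> O[at_right 0](\<lambda>s. s ^ Suc d)"
      by (rule sum_in_bigo(1))
    from bigo_mult_bounded(2) [OF this, of "\<lambda>_. c"] show ?thesis
      by simp
  qed
  have "(\<lambda>s. \<Sum>j\<le>d. coeff p j * fact (j + a) * fact (j + e + b) * (real m * real d) ^ (d - j) *
      (A j s * s ^ (2 * (d - j)) + (A j s + 1) * (B j s * s ^ (2 * (d - j)))))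
     \<in> O[at_right 0](\<lambda>s. s ^ Suc d)"
    by (intro big_sum_in_bigo summand) auto
  moreover have "eventually (\<lambda>s. (\<Sum>j\<le>d. coeff p j * fact (j + a) * fact (j + e + b) * (real m * real d) ^ (d - j) *
      (A j s * s ^ (2 * (d - j)) + (A j s + 1) * (B j s * s ^ (2 * (d - j)))))
      = W a b (f s) (g s) - Wlead a b (s\<^sup>2)) (at_right 0)"
    using ev
  proof eventually_elim
    case (elim s)
    have sq: "(real m * real d * s\<^sup>2) ^ (d - j) = (real m * real d) ^ (d - j) * s ^ (2 * (d - j))" for j
      by (simp add: power_mult_distrib power_mult)
    have AB: "gamQ (j + a) (\<rho> * q * f s) = A j s + 1" "gamQ (j + e + b) (\<rho> * q * g s) = B j s + 1" for j
      by (simp_all add: A_def B_def)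
    have fg: "real m * real d * (f s * g s) = real m * real d * s\<^sup>2"
      using elim by simp
    show ?case
      unfolding W_def Wlead_def id_apply of_real_eq_id fg AB sq sum_subtractf [symmetric]
      by (intro sum.cong refl) (simp add: algebra_simps)
  qed
  ultimately show ?thesis
    using landau_o.big.in_cong [THEN iffD1] by fastforce
qed

section \<open>Comparison with the finite R-transform\<close>

lemma Efps_nth:
  "i \<le> d \<Longrightarrow> fact m * fact d * fps_nth (Efps m d p) i
     = coeff p (d - i) * fact (d - i) * fact (m - i) * (real m * real d) ^ i"
proof -
  assume "i \<le> d"
  have "(-1) ^ i * ((-1) ^ i * c) = (c :: real)" for c
    by (simp flip: mult.assoc power_mult_distrib)
  then show ?thesis
    using \<open>i \<le> d\<close> by (simp add: Efps_def pcoef_def)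
qed

lemma Efps_nth_0: "fps_nth (Efps m d p) 0 = 1"
  using lead_p degree_p by (simp add: Efps_def pcoef_def)

text \<open>The constant term of \<open>E\<close> is 1, so the quotient defining \<open>Rfps\<close>
  can be multiplied out.\<close>

lemma Rfps_mult_Efps: "fps_const (real d) * (Rfps m d p * Efps m d p) = - (fps_X * fps_deriv (Efps m d p))"
proof -
  have "Rfps m d p * Efps m d p = - fps_const (1 / real d) * fps_X * fps_deriv (Efps m d p)"
    unfolding Rfps_def using Efps_nth_0 by (subst fps_times_divide_eq) (auto simp: subdegree_eq_0_iff)
  then have "fps_const (real d) * (Rfps m d p * Efps m d p)
      = - ((fps_const (real d) * fps_const (1 / real d)) * (fps_X * fps_deriv (Efps m d p)))"
    by (simp only: mult_minus_left mult_minus_right mult.assoc)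
  also have "fps_const (real d) * fps_const (1 / real d) = 1"
    using d_ge_1 by simp
  finally show ?thesis by simp
qed

lemma Wlead_reindex:
  "Wlead a b x = (\<Sum>i\<le>d. coeff p (d - i) * fact (d - i + a) * fact (m - i + b) * (real m * real d) ^ i * x ^ i)"
proof -
  have "m - (d - j) = j + e" if "j \<le> d" for j
    using that d_le_m by simp
  then show ?thesis
    unfolding Wlead_def
    by (intro sum.reindex_bij_witness [of _ "\<lambda>i. d - i" "\<lambda>i. d - i"]) (auto simp: power_mult_distrib)
qed

lemma Wlead_00: "Wlead 0 0 x = fact m * fact d * poly (fps_trunc d (Efps m d p)) x"
  unfolding Wlead_reindex poly_fps_trunc sum_distrib_left mult.assoc [symmetric]
  by (intro sum.cong refl) (simp add: Efps_nth)

text \<open>Multiplying \<open>E\<close> by \<open>d R\<close> gives \<open>- X E'\<close>, and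
  \<open>X\<close> times the derivative scales the coefficient of index \<open>i\<close> by
  \<open>i\<close>.\<close>

lemma Efps_Rfps_nth:
  "fps_nth (Efps m d p * (fps_const c + fps_const (real d) * Rfps m d p)) i = (c - real i) * fps_nth (Efps m d p) i"
proof -
  have "Efps m d p * (fps_const c + fps_const (real d) * Rfps m d p)
      = fps_const c * Efps m d p + fps_const (real d) * (Rfps m d p * Efps m d p)"
    by (simp only: distrib_left mult_ac)
  also have "\<dots> = fps_const c * Efps m d p - fps_X * fps_deriv (Efps m d p)"
    unfolding Rfps_mult_Efps by simp
  finally have eq: "Efps m d p * (fps_const c + fps_const (real d) * Rfps m d p)
      = fps_const c * Efps m d p - fps_X * fps_deriv (Efps m d p)" .
  show ?thesis
    unfolding eq by (cases i) (auto simp: algebra_simps)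
qed

text \<open>Raising \<open>a\<close> to 1 replaces \<open>(d - i)!\<close> by
  \<open>(d - i + 1)!\<close>, a factor \<open>d + 1 - i\<close>; this is
  \<open>Efps_Rfps_nth\<close> with \<open>c = d + 1\<close>.\<close>

lemma Wlead_10:
  "Wlead 1 0 x = fact m * fact d * poly (fps_trunc d (Efps m d p * (fps_const (real d + 1) + fps_const (real d) * Rfps m d p))) x"
  unfolding Wlead_reindex poly_fps_trunc sum_distrib_left mult.assoc [symmetric] Efps_Rfps_nth
proof (intro sum.cong refl)
  fix i assume "i \<in> {..d}"
  then have "i \<le> d" by simp
  then have "fact (d - i + 1) = (real d + 1 - real i) * fact (d - i)"
    by (simp add: of_nat_diff algebra_simps)
  then have "coeff p (d - i) * fact (d - i + 1) * fact (m - i + 0) * (real m * real d) ^ i * x ^ i =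
      coeff p (d - i) * fact (d - i) * fact (m - i) * (real m * real d) ^ i * ((real d + 1 - real i) * x ^ i)"
    by (simp only: mult_ac add_0_right)
  also have "\<dots> = fact m * fact d * (real d + 1 - real i) * fps_nth (Efps m d p) i * x ^ i"
    unfolding Efps_nth [OF \<open>i \<le> d\<close>, symmetric] by (simp only: mult_ac)
  finally show "coeff p (d - i) * fact (d - i + 1) * fact (m - i + 0) * (real m * real d) ^ i * x ^ i =
         fact m * fact d * (real d + 1 - real i) * fps_nth (Efps m d p) i * x ^ i" .
qed

text \<open>The same with \<open>(m - i + 1)!\<close>, so that \<open>c = m + 1\<close>.\<close>

lemma Wlead_01:
  "Wlead 0 1 x = fact m * fact d * poly (fps_trunc d (Efps m d p * (fps_const (real m + 1) + fps_const (real d) * Rfps m d p))) x"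
  unfolding Wlead_reindex poly_fps_trunc sum_distrib_left mult.assoc [symmetric] Efps_Rfps_nth
proof (intro sum.cong refl)
  fix i assume "i \<in> {..d}"
  then have "i \<le> d" by simp
  then have "fact (m - i + 1) = (real m + 1 - real i) * fact (m - i)"
    using d_le_m by (simp add: of_nat_diff algebra_simps)
  then have "coeff p (d - i) * fact (d - i + 0) * fact (m - i + 1) * (real m * real d) ^ i * x ^ i =
      coeff p (d - i) * fact (d - i) * fact (m - i) * (real m * real d) ^ i * ((real m + 1 - real i) * x ^ i)"
    by (simp only: mult_ac add_0_right)
  also have "\<dots> = fact m * fact d * (real m + 1 - real i) * fps_nth (Efps m d p) i * x ^ i"
    unfolding Efps_nth [OF \<open>i \<le> d\<close>, symmetric] by (simp only: mult_ac)
  finally show "coeff p (d - i) * fact (d - i + 0) * fact (m - i + 1) * (real m * real d) ^ i * x ^ i =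
         fact m * fact d * (real m + 1 - real i) * fps_nth (Efps m d p) i * x ^ i" .
qed

lemma Rtransform_eq: "Rtransform m d p = fps_trunc d (Rfps m d p)"
  by (simp add: Rtransform_def fps_trunc_def)

lemma poly_fps_trunc_affine:
  "poly (fps_trunc d (fps_const c + fps_const (real d) * Rfps m d p)) x = c + real d * poly (Rtransform m d p) x"
proof -
  have "fps_trunc d (fps_const c + fps_const (real d) * Rfps m d p) = [:c:] + smult (real d) (Rtransform m d p)"
    by (rule poly_eqI) (auto simp: coeff_fps_trunc Rtransform_eq coeff_pCons split: nat.splits)
  then show ?thesis by simp
qed

text \<open>The truncation of a product and the product of truncations agree through degree
  \<open>d\<close>, so they differ at \<open>s^2\<close> by \<open>O(s ^ (d + 1))\<close>.\<close>

lemma Wlead_product_bigo: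
  fixes c :: real
  defines "F \<equiv> Efps m d p"
  shows "(\<lambda>s. poly (fps_trunc d (F * (fps_const c + fps_const (real d) * Rfps m d p))) (s\<^sup>2)
     - poly (fps_trunc d F) (s\<^sup>2) * (c + real d * poly (Rtransform m d p) (s\<^sup>2)))
     \<in> O[at_right 0](\<lambda>s. s ^ Suc d)"
proof -
  let ?G = "fps_const c + fps_const (real d) * Rfps m d p"
  have "(\<lambda>s. poly (fps_trunc d (F * ?G) - fps_trunc d F * fps_trunc d ?G) (s\<^sup>2)) \<in> O[at_right 0](\<lambda>s. s ^ Suc d)"
    by (rule poly_square_bigo) (simp add: coeff_fps_trunc_mult)
  then show ?thesis
    by (simp add: poly_fps_trunc_affine del: power_Suc)
qed

lemma Rtransform_0: "poly (Rtransform m d p) 0 = 0"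
proof -
  have "real d * fps_nth (Rfps m d p) 0 = 0"
    using arg_cong [OF Rfps_mult_Efps, of "\<lambda>F. fps_nth F 0"] Efps_nth_0 by simp
  then show ?thesis
    using d_ge_1 by (simp add: Rtransform_eq poly_0_coeff_0 coeff_fps_trunc)
qed

text \<open>Completing the square: \<open>offset\<close> is the mean of \<open>(d + 1) / d\<close>
  and \<open>(m + 1) / d\<close>, and \<open>rad0\<close> is the square of half their
  difference.\<close>

lemma offset_square:
  "(offset + x)\<^sup>2 = (real d + 1 + real d * x) * (real m + 1 + real d * x) / (real d)\<^sup>2 + rad0"
  using d_ge_1 d_le_m by (simp add: lam_def field_simps power2_eq_square)

lemma offset_gt_1: "1 < offset"
proof -
  have "1 \<le> (lam m d + 1) / (2 * lam m d)" "0 < 1 / real d"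
    using lam_bounds d_ge_1 by (auto simp: field_simps)
  then show ?thesis by linarith
qed

text \<open>Modulo \<open>s ^ (d + 1)\<close>, \<open>w 0 0\<close>, \<open>w 1 0\<close> and
  \<open>w 0 1\<close> equal \<open>E\<close>, \<open>E * V1\<close> and \<open>E * V2\<close>, so
  the radicand agrees with \<open>(offset + R)^2\<close>. Dividing the difference of squares by the
  sum of the roots, which stays away from 0, passes to the square root.\<close>

lemma sqrt_W_bigo:
  assumes f: "f \<in> O[at_right 0](\<lambda>s. s)" and g: "g \<in> O[at_right 0](\<lambda>s. s)"
    and ev: "eventually (\<lambda>s. 0 < f s \<and> 0 < g s \<and> f s * g s = s\<^sup>2) (at_right 0)"
  shows "(\<lambda>s. sqrt (W 1 0 (f s) (g s) * W 0 1 (f s) (g s) / ((real d)\<^sup>2 * (W 0 0 (f s) (g s))\<^sup>2) + rad0)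
      - (offset + poly (Rtransform m d p) (s\<^sup>2))) \<in> O[at_right 0](\<lambda>s. s ^ Suc d)"
proof -
  let ?O = "O[at_right 0](\<lambda>s::real. s ^ Suc d)"
  define K :: real where "K = fact m * fact d"
  define w where "w a b s = W a b (f s) (g s)" for a b s
  define E where "E s = K * poly (fps_trunc d (Efps m d p)) (s\<^sup>2)" for s
  define R where "R s = poly (Rtransform m d p) (s\<^sup>2)" for s
  define V where "V c s = c + real d * R s" for c s
  note fg0 = bigo_id_tendsto_0 [OF f] bigo_id_tendsto_0 [OF g]
  have wlim: "(w a b \<longlongrightarrow> fact (d + a) * fact (m + b)) (at_right 0)" for a b
    unfolding w_def by (rule W_tendsto) fact+
  have Rlim: "(R \<longlongrightarrow> 0) (at_right 0)"
    unfolding R_def using poly_square_tendsto [of "Rtransform m d p"] by (simp add: Rtransform_0)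
  have Elim: "(E \<longlongrightarrow> K * poly (fps_trunc d (Efps m d p)) 0) (at_right 0)"
    unfolding E_def by (intro tendsto_intros poly_square_tendsto)
  have Vlim: "(V c \<longlongrightarrow> c + real d * 0) (at_right 0)" for c
    unfolding V_def by (intro tendsto_intros Rlim)
  note bd = tendsto_imp_bigo_1
  have w00: "(\<lambda>s. w 0 0 s - E s) \<in> ?O"
    using W_sub_Wlead_bigo [OF assms, of 0 0] by (simp add: w_def E_def K_def Wlead_00)
  have lead: "(\<lambda>s. w a b s - E s * V c s) \<in> ?O"
    if "\<And>x. Wlead a b x = K * poly (fps_trunc d (Efps m d p * (fps_const c + fps_const (real d) * Rfps m d p))) x" for a b c
  proof -
    have "(\<lambda>s. K * (poly (fps_trunc d (Efps m d p * (fps_const c + fps_const (real d) * Rfps m d p))) (s\<^sup>2)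
     - poly (fps_trunc d (Efps m d p)) (s\<^sup>2) * V c s)) \<in> ?O"
      using bigo_mult_bounded(2) [OF Wlead_product_bigo, of "\<lambda>_. K"] by (simp add: V_def R_def)
    from sum_in_bigo(1) [OF W_sub_Wlead_bigo [OF assms, of a b] this]
    show ?thesis
      by (simp add: w_def E_def that algebra_simps)
  qed
  have w10: "(\<lambda>s. w 1 0 s - E s * V (real d + 1) s) \<in> ?O"
    by (rule lead) (unfold K_def, rule Wlead_10)
  have w01: "(\<lambda>s. w 0 1 s - E s * V (real m + 1) s) \<in> ?O"
    by (rule lead) (unfold K_def, rule Wlead_01)
  define V1 V2 where "V1 = V (real d + 1)" and "V2 = V (real m + 1)"
  define N where "N s = w 1 0 s * w 0 1 s - V1 s * V2 s * (w 0 0 s)\<^sup>2" for s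
  have Vb: "V1 \<in> O[at_right 0](\<lambda>_. 1)" "V2 \<in> O[at_right 0](\<lambda>_. 1)"
    unfolding V1_def V2_def by (rule bd [OF Vlim])+
  have wb: "w a b \<in> O[at_right 0](\<lambda>_. 1)" for a b
    by (rule bd [OF wlim])
  have Eb: "E \<in> O[at_right 0](\<lambda>_. 1)"
    by (rule bd [OF Elim])
  \<comment> \<open>A telescoping form of \<open>N\<close> in which every summand contains one of
    the three small differences and otherwise bounded factors.\<close>
  have "(\<lambda>s. (w 1 0 s - E s * V1 s) * w 0 1 s + E s * (V1 s * (w 0 1 s - E s * V2 s))
      - V1 s * (V2 s * ((w 0 0 s - E s) * (w 0 0 s + E s)))) \<in> ?O"
  proof (rule sum_in_bigo(2) [OF sum_in_bigo(1)])
    show "(\<lambda>s. (w 1 0 s - E s * V1 s) * w 0 1 s) \<in> ?O"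
      using w10 unfolding V1_def [symmetric] by (rule bigo_mult_bounded(1)) (rule wb)
    show "(\<lambda>s. E s * (V1 s * (w 0 1 s - E s * V2 s))) \<in> ?O"
      using w01 unfolding V2_def [symmetric] by (intro bigo_mult_bounded(2) [OF _ Eb] bigo_mult_bounded(2) [OF _ Vb(1)])
    show "(\<lambda>s. V1 s * (V2 s * ((w 0 0 s - E s) * (w 0 0 s + E s)))) \<in> ?O"
      by (intro bigo_mult_bounded(2) [OF _ Vb(1)] bigo_mult_bounded(2) [OF _ Vb(2)]
          bigo_mult_bounded(1) [OF w00 sum_in_bigo(1) [OF wb Eb]])
  qed
  also have "(\<lambda>s. (w 1 0 s - E s * V1 s) * w 0 1 s + E s * (V1 s * (w 0 1 s - E s * V2 s))
      - V1 s * (V2 s * ((w 0 0 s - E s) * (w 0 0 s + E s)))) = N"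
    by (auto simp: fun_eq_iff N_def algebra_simps power2_eq_square)
  finally have N: "N \<in> ?O" .
  have "((\<lambda>s. 1 / ((real d)\<^sup>2 * (w 0 0 s)\<^sup>2)) \<longlongrightarrow> 1 / ((real d)\<^sup>2 * (fact (d + 0) * fact (m + 0))\<^sup>2)) (at_right 0)"
    using d_ge_1 by (intro tendsto_intros wlim) auto
  from bigo_mult_bounded(1) [OF N bd [OF this]]
  have quot: "(\<lambda>s. N s / ((real d)\<^sup>2 * (w 0 0 s)\<^sup>2)) \<in> ?O"
    by simp
  define S where "S s = w 1 0 s * w 0 1 s / ((real d)\<^sup>2 * (w 0 0 s)\<^sup>2) + rad0" for s
  have pos: "eventually (\<lambda>s. 0 < w a b s) (at_right 0)" for a b
    by (rule order_tendstoD(1) [OF wlim]) simp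
  have Rsmall: "eventually (\<lambda>s. - (1/2) < R s) (at_right 0)"
    by (rule order_tendstoD(1) [OF Rlim]) simp
  have "(\<lambda>s. sqrt (S s) - (offset + R s)) \<in> O[at_right 0](\<lambda>s. N s / ((real d)\<^sup>2 * (w 0 0 s)\<^sup>2))"
  proof (rule bigoI [of _ 2])
    show "eventually (\<lambda>s. norm (sqrt (S s) - (offset + R s)) \<le> 2 * norm (N s / ((real d)\<^sup>2 * (w 0 0 s)\<^sup>2))) (at_right 0)"
      using pos [of 0 0] pos [of 1 0] pos [of 0 1] Rsmall
    proof eventually_elim
      case (elim s)
      have "0 \<le> S s"
        using elim by (simp add: S_def)
      have "S s - (offset + R s)\<^sup>2 = N s / ((real d)\<^sup>2 * (w 0 0 s)\<^sup>2)"
        using elim d_ge_1 by (simp only: offset_square) (simp add: S_def N_def V1_def V2_def V_def field_simps)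
      moreover have "S s - x\<^sup>2 = (sqrt (S s) - x) * (sqrt (S s) + x)" for x
        using \<open>0 \<le> S s\<close> by (simp add: algebra_simps power2_eq_square)
      ultimately have "N s / ((real d)\<^sup>2 * (w 0 0 s)\<^sup>2) = (sqrt (S s) - (offset + R s)) * (sqrt (S s) + (offset + R s))"
        by simp
      \<comment> \<open>From \<open>offset > 1\<close> and \<open>R s > - 1/2\<close>; the
        reciprocal of this bound is the constant 2 above.\<close>
      moreover have half: "1 / 2 \<le> sqrt (S s) + (offset + R s)"
        using elim(4) offset_gt_1 real_sqrt_ge_zero [OF \<open>0 \<le> S s\<close>] by linarith
      then have "\<bar>sqrt (S s) - (offset + R s)\<bar> * (1 / 2) \<le> \<bar>sqrt (S s) - (offset + R s)\<bar> * \<bar>sqrt (S s) + (offset + R s)\<bar>"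
        by (intro mult_left_mono abs_ge_zero order_trans [OF _ abs_ge_self])
      ultimately show ?case
        by (simp add: abs_mult)
    qed
  qed
  from landau_o.big_trans [OF this quot] show ?thesis
    by (simp add: S_def w_def R_def)
qed

end

section \<open>Comparison of the power series coefficients\<close>

theorem mainTheorem6:
  fixes m d :: nat and p :: "real poly"
  assumes "1 \<le> d" and "d \<le> m"
    and "degree p = d" and "lead_coeff p = 1"
    and "\<forall>z::complex. poly (map_poly complex_of_real p) z = 0 \<longrightarrow> Im z = 0 \<and> 0 \<le> Re z"
  shows "\<exists>(a :: nat \<Rightarrow> real) (\<epsilon> :: real). \<epsilon> > 0
     \<and> (\<forall>s. 0 < s \<and> s < \<epsilon> \<longrightarrow> (\<lambda>k. a k * s ^ k) sums Rtilde m d p s)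
     \<and> (\<forall>k\<le>d. a k = coeff (pcompose (Rtransform m d p) [:0, 0, 1:]) k)"
proof -
  obtain as where "p = (\<Prod>a\<leftarrow>as. [:- a, 1:])" "\<forall>a\<in>set as. 0 \<le> a"
    using real_nonneg_rooted_factorization assms(4,5) by blast
  then interpret nonneg_rooted m d p as
    using assms by unfold_locales auto
  let ?r = "rfun m d p" and ?t = "tfun m d p"
  obtain rC tC where an: "rC analytic_on {0}" "tC analytic_on {0}" "rC 0 = 0" "tC 0 = 0"
    and ev: "eventually (\<lambda>s. rC (of_real s) = of_real (?r s) \<and> tC (of_real s) = of_real (?t s) \<and>
        0 < ?r s \<and> 0 < ?t s \<and> ?r s * ?t s = s\<^sup>2) (at_right 0)"
    using rfun_tfun_analytic by blast
  have ev_r: "eventually (\<lambda>s. rC (of_real s) = of_real (?r s)) (at_right 0)"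
    and ev_t: "eventually (\<lambda>s. tC (of_real s) = of_real (?t s)) (at_right 0)"
    and ev_rt: "eventually (\<lambda>s. 0 < ?r s \<and> 0 < ?t s \<and> ?r s * ?t s = s\<^sup>2) (at_right 0)"
    using ev by (auto elim: eventually_mono)
  have r: "?r \<in> O[at_right 0](\<lambda>s. s)" and t: "?t \<in> O[at_right 0](\<lambda>s. s)"
    using analytic_zero_imp_bigo an ev_r ev_t by blast+
  define S where "S s = W 1 0 (?r s) (?t s) * W 0 1 (?r s) (?t s) / ((real d)\<^sup>2 * (W 0 0 (?r s) (?t s))\<^sup>2) + rad0" for s
  note rt0 = bigo_id_tendsto_0 [OF r] bigo_id_tendsto_0 [OF t]
  have pos: "eventually (\<lambda>s. 0 < W a b (?r s) (?t s)) (at_right 0)" for a b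
    by (rule order_tendstoD(1) [OF W_tendsto [OF rt0]]) simp
  have Rt: "eventually (\<lambda>s. Rtilde m d p s = sqrt (S s) - offset) (at_right 0)"
    using ev_rt pos [of 0 0] by eventually_elim (simp add: Rtilde_eq S_def)
  \<comment> \<open>A complex extension of \<open>Rtilde\<close>, which agrees with it at small
    positive \<open>s\<close> and is analytic at 0.\<close>
  define fC where "fC s = csqrt (W 1 0 (rC s) (tC s) * W 0 1 (rC s) (tC s) / (of_real ((real d)\<^sup>2) * (W 0 0 (rC s) (tC s))\<^sup>2)
      + of_real rad0) - of_real offset" for s
  have "fC analytic_on {0}"
    unfolding fC_def
  proof (intro analytic_intros analytic_on_W an)
    fix z :: complex assume "z \<in> {0}"
    then have z: "z = 0" by simp
    then show "of_real ((real d)\<^sup>2) * (W 0 0 (rC z) (tC z))\<^sup>2 \<noteq> 0"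
      using an d_ge_1 by (simp add: W_0)
    have "W 1 0 (rC z) (tC z) * W 0 1 (rC z) (tC z) / (of_real ((real d)\<^sup>2) * (W 0 0 (rC z) (tC z))\<^sup>2) + of_real rad0
        = complex_of_real (fact (d + 1) * fact (m + 0) * (fact (d + 0) * fact (m + 1)) / ((real d)\<^sup>2 * (fact (d + 0) * fact (m + 0))\<^sup>2) + rad0)"
      by (simp only: z an W_0 of_real_add of_real_mult of_real_divide of_real_power of_real_fact)
    \<comment> \<open>At 0 the radicand is positive, hence off the branch cut of
      \<open>csqrt\<close>.\<close>
    moreover have "0 < fact (d + 1) * fact (m + 0) * (fact (d + 0) * fact (m + 1)) / ((real d)\<^sup>2 * (fact (d + 0) * fact (m + 0))\<^sup>2) + rad0"
      using d_ge_1 by (intro add_pos_nonneg divide_pos_pos mult_pos_pos) auto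
    ultimately show "W 1 0 (rC z) (tC z) * W 0 1 (rC z) (tC z) / (of_real ((real d)\<^sup>2) * (W 0 0 (rC z) (tC z))\<^sup>2) + of_real rad0 \<notin> \<real>\<^sub>\<le>\<^sub>0"
      by (simp only: nonpos_Reals_of_real_iff not_le)
  qed
  moreover have "eventually (\<lambda>s. fC (of_real s) = of_real (Rtilde m d p s)) (at_right 0)"
    using ev_r ev_t Rt pos [of 1 0] pos [of 0 1]
  proof eventually_elim
    case (elim s)
    have "0 \<le> S s"
      using elim(4,5) by (simp add: S_def)
    have "fC (of_real s) = csqrt (of_real (S s)) - of_real offset"
      unfolding fC_def elim(1,2) W_of_real S_def by simp
    then show ?case
      using elim(3) \<open>0 \<le> S s\<close> by (simp add: csqrt_of_real_nonneg)
  qed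
  ultimately obtain a \<epsilon> where a: "0 < \<epsilon>" "\<And>s. 0 < s \<Longrightarrow> s < \<epsilon> \<Longrightarrow> (\<lambda>k. a k * s ^ k) sums Rtilde m d p s"
    using analytic_real_power_series by blast
  define P where "P = pcompose (Rtransform m d p) [:0, 0, 1:]"
  have polyP: "poly P s = poly (Rtransform m d p) (s\<^sup>2)" for s
    by (simp add: P_def poly_pcompose power2_eq_square)
  have diff: "(\<lambda>k. (a k - coeff P k) * s ^ k) sums (Rtilde m d p s - poly P s)" if "0 < s" "s < \<epsilon>" for s
  proof -
    have "(\<lambda>k. coeff P k * s ^ k) sums (\<Sum>k\<le>degree P. coeff P k * s ^ k)"
      by (rule sums_finite) (auto simp: coeff_eq_0)
    from sums_diff [OF a(2) [OF that] this] show ?thesis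
      by (simp add: poly_altdef algebra_simps)
  qed
  have "(\<lambda>s. sqrt (S s) - (offset + poly (Rtransform m d p) (s\<^sup>2))) \<in> O[at_right 0](\<lambda>s. s ^ Suc d)"
    unfolding S_def by (rule sqrt_W_bigo [OF r t ev_rt])
  moreover have "eventually (\<lambda>s. sqrt (S s) - (offset + poly (Rtransform m d p) (s\<^sup>2)) = Rtilde m d p s - poly P s) (at_right 0)"
    using Rt by eventually_elim (simp add: polyP)
  ultimately have "(\<lambda>s. Rtilde m d p s - poly P s) \<in> O[at_right 0](\<lambda>s. s ^ Suc d)"
    using landau_o.big.in_cong by fastforce
  \<comment> \<open>The order \<open>d + 1\<close> annihilates exactly the coefficients of index 0
    to \<open>d\<close> of the difference series.\<close>
  then have "a k = coeff P k" if "k \<le> d" for k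
    using power_series_bigo_imp_coeff_0 [OF a(1) diff, of "Suc d" k] that by simp
  then show ?thesis
    using a unfolding P_def by blast
qed

end
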